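(* Let $\mathfrak g$ be a complex semisimple Lie algebra with compact real form $\mathfrak u$ and Cartan decomposition $\mathfrak g=\mathfrak u\oplus i\mathfrak u$, with Cartan involution $\tau$; let $\mathfrak a\subset i\mathfrak u$ be maximal abelian with positive Weyl chamber $\mathfrak a^+$, and let $H\in\mathrm{cl}(\mathfrak a^+)$. Then the restriction of the form $\Omega_\tau$ of $\mathfrak g$ to the semi-direct product orbit $U_{\mathrm{ad}}\cdot H$ is a symplectic form.
   Context: $\mathcal H_\tau(X,Y)=-\langle X,\tau Y\rangle$ is a Hermitian form on $\mathfrak g$, where $\langle\cdot,\cdot\rangle$ is the complex Cartan-Killing form of $\mathfrak g$, and $\Omega_\tau=\mathrm{Im}\,\mathcal H_\tau$, a (constant) symplectic form on the real vector space $\mathfrak g$. $U$ is the compact connected subgroup of $G=\mathrm{Aut}_0\,\mathfrak g$ with Lie algebra $\mathfrak u$. $U_{\mathrm{ad}}=U\times_{\mathrm{Ad}}i\mathfrak u$ is the semi-direct product of $U$ with the abelian group $\mathfrak s=i\mathfrak u$; it acts on $\mathfrak g=\mathfrak u\oplus i\mathfrak u$ by (the transpose of) its coadjoint representation, and the orbit of $H$ is $$U_{\mathrm{ad}}\cdot H=\bigcup_{Y\in\mathrm{Ad}(U)H}\big(Y+\mathrm{ad}(Y)(i\mathfrak u)\big)\subset\mathfrak g,$$ with $\mathrm{ad}$ the adjoint representation of $\mathfrak g$; it is a submanifold of $\mathfrak g$. *)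

theory Defs
  imports "HOL-Analysis.Analysis" "HOL-Algebra.Group_Action"
begin

section \<open>Complex Lie algebras\<close>

text \<open>
  A finite-dimensional complex Lie algebra is carried by a type of class \<open>euclidean_space\<close>
  together with a complex scalar multiplication \<open>sc\<close> extending the real one. The inner product of
  the type is auxiliary: it only supplies the canonical topology of a finite-dimensional real
  vector space and is not related to the bracket.
\<close>

locale complex_lie_algebra =
  fixes sc :: "complex \<Rightarrow> 'g::euclidean_space \<Rightarrow> 'g"
    and br :: "'g \<Rightarrow> 'g \<Rightarrow> 'g"
  assumes complex_vector_space: "vector_space sc"
    and sc_of_real: "sc (complex_of_real r) X = r *\<^sub>R X"
    and br_linear_left: "Vector_Spaces.linear sc sc (\<lambda>X. br X Y)"
    and br_linear_right: "Vector_Spaces.linear sc sc (br X)"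
    and br_self: "br X X = 0"
    and jacobi: "br X (br Y Z) + br Y (br Z X) + br Z (br X Y) = 0"

definition lie_ideal :: "(complex \<Rightarrow> 'g \<Rightarrow> 'g::ab_group_add) \<Rightarrow> ('g \<Rightarrow> 'g \<Rightarrow> 'g) \<Rightarrow> 'g set \<Rightarrow> bool"
  where "lie_ideal sc br I \<longleftrightarrow> module.subspace sc I \<and> (\<forall>X\<in>I. \<forall>Y. br Y X \<in> I)"

primrec derived_series ::
  "(complex \<Rightarrow> 'g \<Rightarrow> 'g::ab_group_add) \<Rightarrow> ('g \<Rightarrow> 'g \<Rightarrow> 'g) \<Rightarrow> 'g set \<Rightarrow> nat \<Rightarrow> 'g set"
  where
    "derived_series sc br I 0 = I"
  | "derived_series sc br I (Suc n) =
       module.span sc {br X Y | X Y. X \<in> derived_series sc br I n \<and> Y \<in> derived_series sc br I n}"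

definition solvable_in :: "(complex \<Rightarrow> 'g \<Rightarrow> 'g::ab_group_add) \<Rightarrow> ('g \<Rightarrow> 'g \<Rightarrow> 'g) \<Rightarrow> 'g set \<Rightarrow> bool"
  where "solvable_in sc br I \<longleftrightarrow> (\<exists>n. derived_series sc br I n = {0})"

definition semisimple :: "(complex \<Rightarrow> 'g \<Rightarrow> 'g::ab_group_add) \<Rightarrow> ('g \<Rightarrow> 'g \<Rightarrow> 'g) \<Rightarrow> bool"
  where "semisimple sc br \<longleftrightarrow> (\<forall>I. lie_ideal sc br I \<and> solvable_in sc br I \<longrightarrow> I = {0})"

text \<open>
  The trace of an endomorphism \<open>f\<close> of a finite-dimensional subspace \<open>V\<close>, computed in some basis;
  \<open>module.representation scl B v b\<close> is the \<open>b\<close>-coordinate of \<open>v\<close> in the basis \<open>B\<close>.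
  The scalar field is generic, so that the same definition gives the complex Cartan-Killing form
  of the whole algebra and the Killing form of a real subalgebra.
\<close>

definition trace_on :: "('k::field \<Rightarrow> 'v \<Rightarrow> 'v::ab_group_add) \<Rightarrow> 'v set \<Rightarrow> ('v \<Rightarrow> 'v) \<Rightarrow> 'k"
  where "trace_on scl V f =
    (let B = (SOME B. B \<subseteq> V \<and> \<not> module.dependent scl B \<and> module.span scl B = V)
     in \<Sum>b\<in>B. module.representation scl B (f b) b)"

definition killing_form ::
  "('k::field \<Rightarrow> 'v \<Rightarrow> 'v::ab_group_add) \<Rightarrow> ('v \<Rightarrow> 'v \<Rightarrow> 'v) \<Rightarrow> 'v set \<Rightarrow> 'v \<Rightarrow> 'v \<Rightarrow> 'k"
  where "killing_form scl br V X Y = trace_on scl V (\<lambda>Z. br X (br Y Z))"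


section \<open>Compact real forms and Weyl chambers\<close>

definition real_form ::
  "(complex \<Rightarrow> 'g \<Rightarrow> 'g) \<Rightarrow> ('g \<Rightarrow> 'g \<Rightarrow> 'g) \<Rightarrow> 'g::euclidean_space set \<Rightarrow> bool"
  where "real_form sc br u \<longleftrightarrow>
    subspace u \<and> (\<forall>X\<in>u. \<forall>Y\<in>u. br X Y \<in> u) \<and>
    u \<inter> sc \<i> ` u = {0} \<and> (\<forall>Z. \<exists>X\<in>u. \<exists>Y\<in>sc \<i> ` u. Z = X + Y)"

definition compact_real_form ::
  "(complex \<Rightarrow> 'g \<Rightarrow> 'g) \<Rightarrow> ('g \<Rightarrow> 'g \<Rightarrow> 'g) \<Rightarrow> 'g::euclidean_space set \<Rightarrow> bool"
  where "compact_real_form sc br u \<longleftrightarrow>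
    real_form sc br u \<and> (\<forall>X\<in>u. X \<noteq> 0 \<longrightarrow> killing_form scaleR br u X X < 0)"

definition cartan_involution ::
  "(complex \<Rightarrow> 'g \<Rightarrow> 'g) \<Rightarrow> 'g::euclidean_space set \<Rightarrow> ('g \<Rightarrow> 'g) \<Rightarrow> bool"
  where "cartan_involution sc u \<tau> \<longleftrightarrow>
    linear \<tau> \<and> (\<forall>X\<in>u. \<tau> X = X) \<and> (\<forall>Y\<in>sc \<i> ` u. \<tau> Y = - Y)"

definition abelian_subspace :: "('g \<Rightarrow> 'g \<Rightarrow> 'g) \<Rightarrow> 'g::euclidean_space set \<Rightarrow> bool"
  where "abelian_subspace br a \<longleftrightarrow> subspace a \<and> (\<forall>X\<in>a. \<forall>Y\<in>a. br X Y = 0)"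

definition maximal_abelian :: "('g \<Rightarrow> 'g \<Rightarrow> 'g) \<Rightarrow> 'g set \<Rightarrow> 'g::euclidean_space set \<Rightarrow> bool"
  where "maximal_abelian br s a \<longleftrightarrow>
    abelian_subspace br a \<and> a \<subseteq> s \<and>
    (\<forall>b. abelian_subspace br b \<and> b \<subseteq> s \<and> a \<subseteq> b \<longrightarrow> b = a)"

text \<open>
  A root is a functional on \<open>a\<close>; it is represented here by any of its linear extensions to the whole
  space, and only its values on \<open>a\<close> are ever used.
\<close>

definition is_root :: "('g \<Rightarrow> 'g \<Rightarrow> 'g) \<Rightarrow> 'g set \<Rightarrow> ('g::euclidean_space \<Rightarrow> real) \<Rightarrow> bool"
  where "is_root br a \<alpha> \<longleftrightarrow>
    linear \<alpha> \<and> (\<exists>A\<in>a. \<alpha> A \<noteq> 0) \<and> (\<exists>X. X \<noteq> 0 \<and> (\<forall>A\<in>a. br A X = \<alpha> A *\<^sub>R X))"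

text \<open>
  The Weyl chambers are the connected components of the complement of the root hyperplanes. Which of
  them is called positive depends on a choice of positive roots, and every chamber arises that way.
\<close>

definition weyl_chamber :: "('g \<Rightarrow> 'g \<Rightarrow> 'g) \<Rightarrow> 'g set \<Rightarrow> 'g::euclidean_space set \<Rightarrow> bool"
  where "weyl_chamber br a C \<longleftrightarrow> C \<in> components {A\<in>a. \<forall>\<alpha>. is_root br a \<alpha> \<longrightarrow> \<alpha> A \<noteq> 0}"


section \<open>Automorphism groups\<close>

definition Aut_group ::
  "(complex \<Rightarrow> 'g \<Rightarrow> 'g) \<Rightarrow> ('g \<Rightarrow> 'g \<Rightarrow> 'g) \<Rightarrow> ('g::euclidean_space \<Rightarrow>\<^sub>L 'g) monoid"
  where "Aut_group sc br =
    \<lparr>carrier = {k. Vector_Spaces.linear sc sc (blinfun_apply k) \<and> bij (blinfun_apply k) \<and>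
                   (\<forall>X Y. k (br X Y) = br (k X) (k Y))},
     mult = (o\<^sub>L), one = id_blinfun\<rparr>"

definition Aut0 ::
  "(complex \<Rightarrow> 'g \<Rightarrow> 'g) \<Rightarrow> ('g \<Rightarrow> 'g \<Rightarrow> 'g) \<Rightarrow> ('g::euclidean_space \<Rightarrow>\<^sub>L 'g) set"
  where "Aut0 sc br = connected_component_set (carrier (Aut_group sc br)) id_blinfun"

text \<open>\<open>exp_ad br X\<close> is the operator exponential of \<open>ad X = br X\<close>.\<close>

definition exp_ad :: "('g \<Rightarrow> 'g \<Rightarrow> 'g) \<Rightarrow> 'g \<Rightarrow> ('g::euclidean_space \<Rightarrow>\<^sub>L 'g)"
  where "exp_ad br X = Blinfun (\<lambda>Y. \<Sum>n. (br X ^^ n) Y /\<^sub>R fact n)"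

text \<open>
  The Lie algebra of a closed subgroup of \<open>Aut\<^sub>0 g\<close>, where \<open>g\<close> is identified with the Lie algebra
  \<open>ad g\<close> of \<open>Aut\<^sub>0 g\<close> by means of \<open>ad\<close>. With this identification the adjoint action of \<open>k\<close> on \<open>g\<close>
  is \<open>Ad(k) = k\<close>.
\<close>

definition lie_algebra_of ::
  "('g \<Rightarrow> 'g \<Rightarrow> 'g) \<Rightarrow> ('g::euclidean_space \<Rightarrow>\<^sub>L 'g) set \<Rightarrow> 'g set"
  where "lie_algebra_of br U = {X. \<forall>t::real. exp_ad br (t *\<^sub>R X) \<in> U}"

definition compact_group_of ::
  "(complex \<Rightarrow> 'g \<Rightarrow> 'g) \<Rightarrow> ('g \<Rightarrow> 'g \<Rightarrow> 'g) \<Rightarrow> 'g set \<Rightarrow> ('g::euclidean_space \<Rightarrow>\<^sub>L 'g) set \<Rightarrow> bool"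
  where "compact_group_of sc br u U \<longleftrightarrow>
    subgroup U (Aut_group sc br) \<and> U \<subseteq> Aut0 sc br \<and> compact U \<and> connected U \<and>
    lie_algebra_of br U = u"


section \<open>The semi-direct product and its orbits\<close>

definition semidirect ::
  "('g::euclidean_space \<Rightarrow>\<^sub>L 'g) set \<Rightarrow> 'g set \<Rightarrow> (('g \<Rightarrow>\<^sub>L 'g) \<times> 'g) monoid"
  where "semidirect U s =
    \<lparr>carrier = U \<times> s, mult = (\<lambda>(k, X) (l, Z). (k o\<^sub>L l, X + k Z)), one = (id_blinfun, 0)\<rparr>"

text \<open>
  The Lie algebra of \<open>U \<times>\<^bsub>Ad\<^esub> s\<close> is \<open>u \<oplus> s\<close>, with adjoint representation
  \<open>(k, X) (A + B) = k (A + B) + [X, k A]\<close> for \<open>A \<in> u\<close> and \<open>B \<in> s\<close>, where the last term is the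
  translation part. Dualising by the real part of the Cartan-Killing form, for which \<open>u\<close> and \<open>s\<close> are
  orthogonal, and using the invariance of that form, \<open>(k, X)\<close> acts on \<open>v\<close> by
  \<open>k v + [X, P (k v)]\<close>, where \<open>P = (1 - \<tau>) / 2\<close> is the projection onto \<open>s\<close> along \<open>u\<close>.
\<close>

definition coad ::
  "('g \<Rightarrow> 'g \<Rightarrow> 'g) \<Rightarrow> ('g \<Rightarrow> 'g) \<Rightarrow> ('g::euclidean_space \<Rightarrow>\<^sub>L 'g) \<times> 'g \<Rightarrow> 'g \<Rightarrow> 'g"
  where "coad br \<tau> = (\<lambda>(k, X) v. k v + br X ((1/2) *\<^sub>R (k v - \<tau> (k v))))"

definition Uad_orbit ::
  "('g \<Rightarrow> 'g \<Rightarrow> 'g) \<Rightarrow> ('g \<Rightarrow> 'g) \<Rightarrow> ('g::euclidean_space \<Rightarrow>\<^sub>L 'g) set \<Rightarrow> 'g set \<Rightarrow> 'g \<Rightarrow> 'g set"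
  where "Uad_orbit br \<tau> U s H = orbit (semidirect U s) (coad br \<tau>) H"

text \<open>
  The explicit description of the orbit as a union of affine spaces is \<open>Uad_orbit_eq\<close> below; every
  element of \<open>U\<close> preserves its Lie algebra \<open>u\<close>.
\<close>

context complex_lie_algebra begin

lemma linear_br: "linear (br X)"
proof -
  interpret lr: Vector_Spaces.linear sc sc "br X" by (rule br_linear_right)
  show ?thesis
    by (rule linearI) (simp_all add: lr.add lr.scale flip: sc_of_real)
qed

lemma linear_br_left: "linear (\<lambda>X. br X Y)"
proof -
  interpret lr: Vector_Spaces.linear sc sc "\<lambda>X. br X Y" by (rule br_linear_left)
  show ?thesis
    by (rule linearI) (simp_all add: lr.add lr.scale flip: sc_of_real)
qed

lemma br_skew: "br X Y = - br Y X"
proof -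
  have "br (X + Y) (X + Y) = br X Y + br Y X"
    by (simp add: linear_add[OF linear_br] linear_add[OF linear_br_left] br_self[of X] br_self[of Y])
  then have "br X Y + br Y X = 0"
    by (metis br_self)
  then show ?thesis
    by (simp add: eq_neg_iff_add_eq_0)
qed

lemma summable_exp_ad: "summable (\<lambda>n. (br X ^^ n) Y /\<^sub>R fact n)"
proof -
  obtain K where K: "\<And>Z. norm (br X Z) \<le> norm Z * K" "0 \<le> K"
    using bounded_linear.nonneg_bounded linear_br linear_conv_bounded_linear by metis
  have b: "norm ((br X ^^ n) Y) \<le> K ^ n * norm Y" for n
  proof (induction n)
    case (Suc n)
    have "norm ((br X ^^ Suc n) Y) \<le> norm ((br X ^^ n) Y) * K" using K(1) by simp
    also have "\<dots> \<le> (K ^ n * norm Y) * K" using Suc K(2) by (rule mult_right_mono)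
    finally show ?case by (simp add: mult_ac)
  qed simp
  show ?thesis
  proof (rule summable_comparison_test')
    show "summable (\<lambda>n. (K ^ n /\<^sub>R fact n) * norm Y)"
      by (intro summable_mult2 summable_exp_generic)
    show "norm ((br X ^^ n) Y /\<^sub>R fact n) \<le> (K ^ n /\<^sub>R fact n) * norm Y" if "n \<ge> 0" for n
      using b[of n] by (simp add: divide_simps)
  qed
qed

lemma exp_ad_apply: "exp_ad br X Y = (\<Sum>n. (br X ^^ n) Y /\<^sub>R fact n)"
proof -
  have pw: "linear (br X ^^ n)" for n
    by (induction n) (simp_all only: funpow.simps linear_id linear_compose linear_br)
  have "linear (\<lambda>Y. \<Sum>n. (br X ^^ n) Y /\<^sub>R fact n)"
    by (rule linearI)
       (simp_all add: linear_add[OF pw] linear_cmul[OF pw] scaleR_add_right suminf_add summable_exp_ad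
          suminf_scaleR_right[OF summable_exp_ad] mult.commute)
  then show ?thesis
    unfolding exp_ad_def by (simp add: bounded_linear_Blinfun_apply linear_conv_bounded_linear)
qed

lemma group_Aut: "group (Aut_group sc br)"
proof (rule groupI)
  fix k assume k: "k \<in> carrier (Aut_group sc br)"
  then have lk: "Vector_Spaces.linear sc sc (blinfun_apply k)" and bk: "bij (blinfun_apply k)"
    and hk: "\<And>X Y. k (br X Y) = br (k X) (k Y)"
    by (auto simp: Aut_group_def)
  interpret lk: Vector_Spaces.linear sc sc "blinfun_apply k" by (rule lk)
  define g where "g = inv_into UNIV (blinfun_apply k)"
  have gk: "g (k X) = X" and kg: "k (g X) = X" for X
    using bk by (auto simp: g_def bij_is_inj bij_is_surj surj_f_inv_f)
  have gadd: "g (X + Y) = g X + g Y" for X Y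
    by (metis gk kg lk.add)
  have gsc: "g (sc c X) = sc c (g X)" for c X
    by (metis gk kg lk.scale)
  have "linear g"
    by (rule linearI) (simp_all add: gadd gsc flip: sc_of_real)
  then have blg: "bounded_linear g"
    by (simp add: linear_conv_bounded_linear)
  have ag: "blinfun_apply (Blinfun g) = g"
    using blg by (rule bounded_linear_Blinfun_apply)
  have "Vector_Spaces.linear sc sc g"
    using lk gadd gsc by (simp add: Vector_Spaces.linear_iff)
  moreover have "bij g"
    by (rule o_bij[of "blinfun_apply k"]) (auto simp: gk kg fun_eq_iff)
  moreover have "g (br X Y) = br (g X) (g Y)" for X Y
    by (metis gk kg hk)
  ultimately have "Blinfun g \<in> carrier (Aut_group sc br)"
    by (simp add: Aut_group_def ag)
  moreover have "Blinfun g o\<^sub>L k = id_blinfun"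
    by (rule blinfun_eqI) (simp add: ag gk)
  ultimately show "\<exists>h\<in>carrier (Aut_group sc br). h \<otimes>\<^bsub>Aut_group sc br\<^esub> k = \<one>\<^bsub>Aut_group sc br\<^esub>"
    by (auto simp: Aut_group_def)
next
  fix k l assume "k \<in> carrier (Aut_group sc br)" "l \<in> carrier (Aut_group sc br)"
  then show "k \<otimes>\<^bsub>Aut_group sc br\<^esub> l \<in> carrier (Aut_group sc br)"
    using Vector_Spaces.linear_compose[of sc sc "blinfun_apply l" sc "blinfun_apply k"]
    by (auto simp: Aut_group_def bij_comp blinfun_compose.rep_eq)
next
  show "\<one>\<^bsub>Aut_group sc br\<^esub> \<in> carrier (Aut_group sc br)"
    using complex_vector_space
    by (auto simp: Aut_group_def id_blinfun.rep_eq Vector_Spaces.linear_iff bij_def inj_on_def)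
qed (auto simp: Aut_group_def intro!: blinfun_eqI)


lemma compact_group_stabilizes:
  assumes U: "compact_group_of sc br u U" and k: "k \<in> U" and X: "X \<in> u"
  shows "k X \<in> u"
proof -
  have sub: "subgroup U (Aut_group sc br)" and u: "lie_algebra_of br U = u"
    using U by (auto simp: compact_group_of_def)
  define h where "h = inv\<^bsub>Aut_group sc br\<^esub> k"
  have kA: "k \<in> carrier (Aut_group sc br)"
    using sub k by (rule subgroup.mem_carrier)
  have h: "h \<in> U"
    unfolding h_def using sub k by (rule subgroup.m_inv_closed)
  have hom: "k (br A B) = br (k A) (k B)" for A B
    using kA by (auto simp: Aut_group_def)
  have "k o\<^sub>L h = id_blinfun"
    using group.r_inv[OF group_Aut kA] by (simp add: Aut_group_def h_def)
  then have kh: "k (h Z) = Z" for Z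
    by (metis blinfun_apply_blinfun_compose blinfun_apply_id_blinfun)
  have pw: "k ((br A ^^ n) Z) = (br (k A) ^^ n) (k Z)" for A Z n
    by (induction n) (simp_all add: hom)
  have "exp_ad br (t *\<^sub>R k X) = k o\<^sub>L exp_ad br (t *\<^sub>R X) o\<^sub>L h" for t
  proof (rule blinfun_eqI)
    fix Z
    have "k (exp_ad br (t *\<^sub>R X) (h Z)) = (\<Sum>n. k ((br (t *\<^sub>R X) ^^ n) (h Z) /\<^sub>R fact n))"
      unfolding exp_ad_apply
      by (rule bounded_linear.suminf[OF blinfun.bounded_linear_right summable_exp_ad])
    also have "\<dots> = exp_ad br (t *\<^sub>R k X) Z"
      by (simp add: exp_ad_apply blinfun.scaleR_right pw kh)
    finally show "exp_ad br (t *\<^sub>R k X) Z = (k o\<^sub>L exp_ad br (t *\<^sub>R X) o\<^sub>L h) Z"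
      by simp
  qed
  moreover have "k o\<^sub>L exp_ad br (t *\<^sub>R X) o\<^sub>L h \<in> U" for t
  proof -
    have "exp_ad br (t *\<^sub>R X) \<in> U"
      using X u by (auto simp: lie_algebra_of_def)
    then show ?thesis
      using subgroup.m_closed[OF sub] k h by (simp add: Aut_group_def)
  qed
  ultimately show ?thesis
    using u by (auto simp: lie_algebra_of_def)
qed

lemma Uad_orbit_eq:
  assumes u: "real_form sc br u" and \<tau>: "cartan_involution sc u \<tau>"
    and U: "compact_group_of sc br u U" and H: "H \<in> sc \<i> ` u"
  shows "Uad_orbit br \<tau> U (sc \<i> ` u) H =
    (\<Union>Y\<in>(\<lambda>k. blinfun_apply k H) ` U. (\<lambda>X. Y + br Y X) ` (sc \<i> ` u))"
proof -
  have kH: "k H \<in> sc \<i> ` u" if k: "k \<in> U" for k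
  proof -
    obtain X where X: "X \<in> u" "H = sc \<i> X" using H by auto
    have "k \<in> carrier (Aut_group sc br)"
      using U k by (auto simp: compact_group_of_def dest: subgroup.mem_carrier)
    then have "k H = sc \<i> (k X)"
      by (simp add: X Aut_group_def Vector_Spaces.linear_iff)
    then show ?thesis
      using compact_group_stabilizes[OF U k X(1)] by auto
  qed
  have proj: "(1/2) *\<^sub>R (k H - \<tau> (k H)) = k H" if "k \<in> U" for k
  proof -
    have "\<tau> (k H) = - k H"
      using \<tau> kH[OF that] by (auto simp: cartan_involution_def)
    then show ?thesis
      by (simp flip: scaleR_2)
  qed
  have neg: "- X \<in> sc \<i> ` u" if X: "X \<in> sc \<i> ` u" for X
  proof -
    obtain Y where Y: "Y \<in> u" "X = sc \<i> Y" using X by auto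
    interpret vector_space sc by (rule complex_vector_space)
    have "- X = sc \<i> (- Y)" by (simp add: Y)
    moreover have "- Y \<in> u" using u Y by (simp add: real_form_def real_vector.subspace_neg)
    ultimately show ?thesis by blast
  qed
  have flip: "br X Y = br Y (- X)" for X Y
    by (simp add: br_skew[of X Y] linear_neg[OF linear_br])
  have "Uad_orbit br \<tau> U (sc \<i> ` u) H = {blinfun_apply k H + br X (blinfun_apply k H) |k X. k \<in> U \<and> X \<in> sc \<i> ` u}"
    by (simp add: Uad_orbit_def orbit_def semidirect_def coad_def) (metis (no_types, lifting) proj)
  also have "\<dots> = (\<Union>Y\<in>(\<lambda>k. blinfun_apply k H) ` U. (\<lambda>X. Y + br Y X) ` (sc \<i> ` u))"
  proof (intro equalityI subsetI)
    fix Z assume "Z \<in> {blinfun_apply k H + br X (blinfun_apply k H) |k X. k \<in> U \<and> X \<in> sc \<i> ` u}"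
    then obtain k X where *: "k \<in> U" "X \<in> sc \<i> ` u" "Z = k H + br X (k H)" by blast
    then have "Z = k H + br (k H) (- X)" using flip by metis
    then show "Z \<in> (\<Union>Y\<in>(\<lambda>k. blinfun_apply k H) ` U. (\<lambda>X. Y + br Y X) ` (sc \<i> ` u))"
      using * neg by blast
  next
    fix Z assume "Z \<in> (\<Union>Y\<in>(\<lambda>k. blinfun_apply k H) ` U. (\<lambda>X. Y + br Y X) ` (sc \<i> ` u))"
    then obtain k X where *: "k \<in> U" "X \<in> sc \<i> ` u" "Z = k H + br (k H) X" by blast
    then have "Z = k H + br (- X) (k H)" using flip[of "- X"] by simp
    then show "Z \<in> {blinfun_apply k H + br X (blinfun_apply k H) |k X. k \<in> U \<and> X \<in> sc \<i> ` u}"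
      using * neg by blast
  qed
  finally show ?thesis .
qed

end

definition hermitian_form ::
  "(complex \<Rightarrow> 'g \<Rightarrow> 'g) \<Rightarrow> ('g \<Rightarrow> 'g \<Rightarrow> 'g) \<Rightarrow> ('g::euclidean_space \<Rightarrow> 'g) \<Rightarrow> 'g \<Rightarrow> 'g \<Rightarrow> complex"
  where "hermitian_form sc br \<tau> X Y = - killing_form sc br UNIV X (\<tau> Y)"

definition Omega ::
  "(complex \<Rightarrow> 'g \<Rightarrow> 'g) \<Rightarrow> ('g \<Rightarrow> 'g \<Rightarrow> 'g) \<Rightarrow> ('g::euclidean_space \<Rightarrow> 'g) \<Rightarrow> 'g \<Rightarrow> 'g \<Rightarrow> real"
  where "Omega sc br \<tau> X Y = Im (hermitian_form sc br \<tau> X Y)"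


section \<open>Submanifolds of a Euclidean space and symplectic forms on them\<close>

text \<open>For open \<open>S\<close>, \<open>Ck_on n f S\<close> says that \<open>f\<close> is \<open>n\<close> times continuously differentiable on \<open>S\<close>.\<close>

primrec Ck_on :: "nat \<Rightarrow> ('a::euclidean_space \<Rightarrow> 'b::real_normed_vector) \<Rightarrow> 'a set \<Rightarrow> bool"
  where
    "Ck_on 0 f S \<longleftrightarrow> continuous_on S f"
  | "Ck_on (Suc n) f S \<longleftrightarrow>
       (\<forall>x\<in>S. f differentiable (at x)) \<and> (\<forall>v. Ck_on n (\<lambda>x. frechet_derivative f (at x) v) S)"

text \<open>A map on an arbitrary subset is smooth if it extends locally to smooth maps on open sets.\<close>

definition smooth_on :: "'a::euclidean_space set \<Rightarrow> ('a \<Rightarrow> 'b::real_normed_vector) \<Rightarrow> bool"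
  where "smooth_on S f \<longleftrightarrow>
    (\<forall>x\<in>S. \<exists>V F. open V \<and> x \<in> V \<and> (\<forall>n. Ck_on n F V) \<and> (\<forall>y\<in>S \<inter> V. F y = f y))"

text \<open>
  Local parametrizations are diffeomorphisms from relatively open subsets of a linear subspace \<open>L\<close>
  (in the role of \<open>\<real>\<^sup>d\<close>, with \<open>d = dim L\<close>) onto relatively open subsets of \<open>M\<close>.
\<close>

definition local_param :: "'g::euclidean_space set \<Rightarrow> 'g set \<Rightarrow> 'g set \<Rightarrow> ('g \<Rightarrow> 'g) \<Rightarrow> bool"
  where "local_param M L Q \<psi> \<longleftrightarrow>
    subspace L \<and> openin (top_of_set L) Q \<and> openin (top_of_set M) (\<psi> ` Q) \<and>
    inj_on \<psi> Q \<and> smooth_on Q \<psi> \<and> smooth_on (\<psi> ` Q) (inv_into Q \<psi>)"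

definition submanifold :: "nat \<Rightarrow> 'g::euclidean_space set \<Rightarrow> bool"
  where "submanifold d M \<longleftrightarrow>
    (\<forall>p\<in>M. \<exists>L Q \<psi>. local_param M L Q \<psi> \<and> dim L = d \<and> p \<in> \<psi> ` Q)"

definition tangent_space :: "'g::euclidean_space set \<Rightarrow> 'g \<Rightarrow> 'g set"
  where "tangent_space M p =
    {v. \<exists>\<gamma> e. e > 0 \<and> smooth_on {-e<..<e::real} \<gamma> \<and> \<gamma> ` {-e<..<e} \<subseteq> M \<and>
              \<gamma> 0 = p \<and> (\<gamma> has_vector_derivative v) (at 0)}"

text \<open>
  A 2-form on \<open>M\<close> is a function \<open>\<omega>\<close> of a point \<open>p\<close> and two vectors; only its values for \<open>p \<in> M\<close> and
  vectors tangent to \<open>M\<close> at \<open>p\<close> are used, so that a form on the ambient space can be restricted to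
  \<open>M\<close> without changing \<open>\<omega>\<close>.
\<close>

definition dir_deriv :: "('g::real_normed_vector \<Rightarrow> 'b::real_normed_vector) \<Rightarrow> 'g \<Rightarrow> 'g \<Rightarrow> 'b"
  where "dir_deriv f x v = vector_derivative (\<lambda>t::real. f (x + t *\<^sub>R v)) (at 0)"

definition pullback_form ::
  "('g::real_normed_vector \<Rightarrow> 'g) \<Rightarrow> ('g \<Rightarrow> 'g \<Rightarrow> 'g \<Rightarrow> real) \<Rightarrow> 'g \<Rightarrow> 'g \<Rightarrow> 'g \<Rightarrow> real"
  where "pullback_form \<psi> \<omega> x v w = \<omega> (\<psi> x) (dir_deriv \<psi> x v) (dir_deriv \<psi> x w)"

definition two_form_on :: "'g::euclidean_space set \<Rightarrow> ('g \<Rightarrow> 'g \<Rightarrow> 'g \<Rightarrow> real) \<Rightarrow> bool"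
  where "two_form_on M \<omega> \<longleftrightarrow>
    (\<forall>p\<in>M. \<forall>u\<in>tangent_space M p. \<forall>v\<in>tangent_space M p. \<forall>w\<in>tangent_space M p. \<forall>c.
        \<omega> p (u + v) w = \<omega> p u w + \<omega> p v w \<and> \<omega> p (c *\<^sub>R u) w = c * \<omega> p u w \<and>
        \<omega> p u w = - \<omega> p w u) \<and>
    (\<forall>L Q \<psi>. local_param M L Q \<psi> \<longrightarrow>
        (\<forall>v\<in>L. \<forall>w\<in>L. smooth_on Q (\<lambda>x. pullback_form \<psi> \<omega> x v w)))"

text \<open>\<open>d\<omega> = 0\<close>, expressed by the usual coordinate formula in every local parametrization.\<close>

definition closed_form_on :: "'g::euclidean_space set \<Rightarrow> ('g \<Rightarrow> 'g \<Rightarrow> 'g \<Rightarrow> real) \<Rightarrow> bool"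
  where "closed_form_on M \<omega> \<longleftrightarrow>
    (\<forall>L Q \<psi>. local_param M L Q \<psi> \<longrightarrow>
      (\<forall>x\<in>Q. \<forall>u\<in>L. \<forall>v\<in>L. \<forall>w\<in>L.
          dir_deriv (\<lambda>y. pullback_form \<psi> \<omega> y v w) x u
        - dir_deriv (\<lambda>y. pullback_form \<psi> \<omega> y u w) x v
        + dir_deriv (\<lambda>y. pullback_form \<psi> \<omega> y u v) x w = 0))"

definition nondegenerate_on :: "'g::euclidean_space set \<Rightarrow> ('g \<Rightarrow> 'g \<Rightarrow> 'g \<Rightarrow> real) \<Rightarrow> bool"
  where "nondegenerate_on M \<omega> \<longleftrightarrow>
    (\<forall>p\<in>M. \<forall>v\<in>tangent_space M p. (\<forall>w\<in>tangent_space M p. \<omega> p v w = 0) \<longrightarrow> v = 0)"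

definition symplectic_form_on :: "'g::euclidean_space set \<Rightarrow> ('g \<Rightarrow> 'g \<Rightarrow> 'g \<Rightarrow> real) \<Rightarrow> bool"
  where "symplectic_form_on M \<omega> \<longleftrightarrow>
    (\<exists>d. submanifold d M) \<and> two_form_on M \<omega> \<and> closed_form_on M \<omega> \<and> nondegenerate_on M \<omega>"

end

theory Submission
  imports Defs
begin

text \<open>
  Write \<open>H = i h\<close>, let \<open>m = [h, u]\<close>, and identify \<open>g\<close> with \<open>u \<oplus> u\<close> by \<open>(a, b) \<mapsto> i a + b\<close>. The orbit is
  the tangent bundle \<open>{k (i h + b) | k \<in> U, b \<in> m}\<close> of the adjoint orbit of \<open>h\<close>, and \<open>\<Omega>\<^sub>\<tau>\<close> becomes
  \<open>\<beta> b a' - \<beta> a b'\<close> with \<open>\<beta>\<close> the negative definite Killing form of \<open>u\<close>. A constant form is closed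
  on every submanifold, and nondegeneracy on a tangent space follows from testing first against the
  fibre directions \<open>k m\<close> and then against the remaining ones.

  The orbit is homogeneous under linear maps, so a chart is only needed at \<open>i h\<close>; there the inverse
  function theorem applies to a product of exponentials times a slice. That the slice meets the orbit
  only in the expected points replaces the closed subgroup theorem: if \<open>k h = h + s\<close> with
  \<open>[h, s] = 0\<close> and \<open>k \<in> U\<close> close to the identity, a trace computation gives \<open>s = 0\<close>, and compactness
  of \<open>U\<close> provides such a \<open>k\<close> for every orbit point close to \<open>h\<close>.
\<close>

section \<open>Calculus of maps of class \<open>C\<^sup>k\<close>\<close>

text \<open>What is known of \<open>U\<close> near the identity is which one-parameter groups it
  contains. A priori the orbit could therefore return to its base point along further sheets, and a
  parametrization of one sheet would not be a chart. This is why the chart is the restriction of a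
  diffeomorphism \<open>f\<close> between open sets of the whole space, with f x = k (w x) for some
  k in \<open>U\<close>: every orbit point in the image has the form f x, and undoing k leaves the
  question which slice points i (h + s) + b, with s centralizing h, lie in the orbit. The trace
  argument decides it because replacing k by the identity costs an error of order |k - 1| |s|^2, of
  the same order in s as the negative number \<beta> s s, so a bound on |k - 1| independent of s
  suffices. Smoothness in \<open>local_param\<close> is required of the inverse as well, hence the
  induction that lifts the inverse function theorem to all classes C^k.\<close>

lemma Ck_on_SucD:
  assumes "Ck_on (Suc n) f S"
  shows "x \<in> S \<Longrightarrow> (f has_derivative frechet_derivative f (at x)) (at x)"
    and "Ck_on n (\<lambda>x. frechet_derivative f (at x) v) S"
  using assms frechet_derivative_works by auto

lemma Ck_on_cong:
  assumes "open S" "\<And>x. x \<in> S \<Longrightarrow> f x = g x" "Ck_on n f S"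
  shows "Ck_on n g S"
  using assms
proof (induction n arbitrary: f g)
  case 0
  then show ?case by (metis Ck_on.simps(1) continuous_on_cong)
next
  case (Suc n)
  have d: "(g has_derivative frechet_derivative f (at x)) (at x)" if "x \<in> S" for x
    by (rule has_derivative_transform_within_open[of f _ _ _ S])
      (use Suc.prems that frechet_derivative_works in auto)
  then have "frechet_derivative f (at x) = frechet_derivative g (at x)" if "x \<in> S" for x
    using that frechet_derivative_at by blast
  then have "Ck_on n (\<lambda>x. frechet_derivative g (at x) v) S" for v
    by (intro Suc.IH[OF Suc.prems(1) _ Ck_on_SucD(2)[OF Suc.prems(3)]]) simp
  then show ?case
    using d by (auto simp: differentiable_def)
qed

text \<open>Uniqueness of derivatives lets an explicit formula replace
  \<open>frechet_derivative\<close>; the inductions below enter the successor case through this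
  rule.\<close>

lemma Ck_on_SucI:
  assumes "open S" "\<And>x. x \<in> S \<Longrightarrow> (f has_derivative f' x) (at x)"
    and "\<And>v. Ck_on n (\<lambda>x. f' x v) S"
  shows "Ck_on (Suc n) f S"
proof -
  have "frechet_derivative f (at x) = f' x" if "x \<in> S" for x
    using assms(2)[OF that] frechet_derivative_at by metis
  then have "Ck_on n (\<lambda>x. frechet_derivative f (at x) v) S" for v
    by (intro Ck_on_cong[OF assms(1) _ assms(3)[of v]]) simp
  then show ?thesis
    using assms(2) by (auto simp: differentiable_def)
qed

lemma Ck_on_subset: "Ck_on n f S \<Longrightarrow> T \<subseteq> S \<Longrightarrow> Ck_on n f T"
  by (induction n arbitrary: f) (auto intro: continuous_on_subset)

text \<open>The successor clause of \<open>Ck_on\<close> speaks about the directional derivatives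
  and not about the class of \<open>f\<close> itself. Descending by one class is an induction whose
  base case is that differentiability implies continuity.\<close>

lemma Ck_on_less:
  assumes "open S" "Ck_on (Suc n) f S"
  shows "Ck_on n f S"
  using assms(2)
proof (induction n arbitrary: f)
  case 0
  then show ?case
    by (auto intro!: continuous_at_imp_continuous_on differentiable_imp_continuous_within)
next
  case (Suc n)
  show ?case
    by (rule Ck_on_SucI[OF assms(1) Ck_on_SucD(1)[OF Suc.prems] Suc.IH[OF Ck_on_SucD(2)[OF Suc.prems]]])
qed

lemma Ck_on_const: "Ck_on n (\<lambda>x. c) S"
  by (induction n arbitrary: c) (auto simp: frechet_derivative_const)

lemma Ck_on_imp_continuous_on:
  assumes "open S" "Ck_on n f S" shows "continuous_on S f"
  using assms(2)
proof (induction n)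
  case (Suc n)
  then show ?case using Ck_on_less[OF assms(1) Suc.prems] by blast
qed simp

lemma Ck_on_add:
  assumes S: "open S"
  shows "Ck_on n f S \<Longrightarrow> Ck_on n g S \<Longrightarrow> Ck_on n (\<lambda>x. f x + g x) S"
proof (induction n arbitrary: f g)
  case (Suc n)
  show ?case
    by (rule Ck_on_SucI[OF S has_derivative_add])
      (use Ck_on_SucD[OF Suc.prems(1)] Ck_on_SucD[OF Suc.prems(2)] Suc.IH in auto)
qed (auto intro: continuous_on_add)

lemma Ck_on_sum:
  assumes S: "open S" and "\<And>i. i \<in> I \<Longrightarrow> Ck_on n (f i) S"
  shows "Ck_on n (\<lambda>x. \<Sum>i\<in>I. f i x) S"
  using assms(2) by (induction I rule: infinite_finite_induct) (auto intro: Ck_on_const Ck_on_add[OF S])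

lemma Ck_on_linear:
  assumes S: "open S" and l: "bounded_linear l"
  shows "Ck_on n f S \<Longrightarrow> Ck_on n (\<lambda>x. l (f x)) S"
proof (induction n arbitrary: f)
  case 0
  then show ?case
    using bounded_linear.continuous_on[OF l] by auto
next
  case (Suc n)
  show ?case
    by (rule Ck_on_SucI[OF S bounded_linear.has_derivative[OF l]])
      (use Ck_on_SucD[OF Suc.prems(1)] Suc.IH in auto)
qed

lemma Ck_on_ident:
  assumes S: "open S" shows "Ck_on n (\<lambda>x. x) S"
proof (cases n)
  case (Suc m)
  show ?thesis unfolding Suc
    by (rule Ck_on_SucI[OF S has_derivative_ident]) (rule Ck_on_const)
qed auto

text \<open>The product rule pairs each derivative with the other, undifferentiated factor, so the
  induction hypothesis also needs both factors one class lower.\<close>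

lemma Ck_on_bilinear:
  assumes S: "open S" and b: "bounded_bilinear b"
  shows "Ck_on n f S \<Longrightarrow> Ck_on n g S \<Longrightarrow> Ck_on n (\<lambda>x. b (f x) (g x)) S"
proof (induction n arbitrary: f g)
  case 0
  then show ?case
    using bounded_bilinear.continuous_on[OF b] by auto
next
  case (Suc n)
  note D = Ck_on_SucD[OF Suc.prems(1)] Ck_on_SucD[OF Suc.prems(2)]
    and L = Ck_on_less[OF S Suc.prems(1)] Ck_on_less[OF S Suc.prems(2)]
  show ?case
    by (rule Ck_on_SucI[OF S bounded_bilinear.FDERIV[OF b]]) (use D L in \<open>auto intro!: Ck_on_add[OF S] Suc.IH\<close>)
qed

text \<open>\<open>Ck_on\<close> controls derivatives in a fixed direction. This expansion trades a
  direction that varies with the point for scalar coefficients and fixed basis directions.\<close>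

lemma has_derivative_basis_sum:
  fixes f :: "'a::euclidean_space \<Rightarrow> 'b::real_normed_vector"
  assumes "(f has_derivative D) F"
  shows "D v = (\<Sum>b\<in>Basis. (v \<bullet> b) *\<^sub>R D b)"
proof -
  interpret D: linear D using assms by (rule has_derivative_linear)
  have "D v = D (\<Sum>b\<in>Basis. (v \<bullet> b) *\<^sub>R b)" by (simp add: euclidean_representation)
  then show ?thesis by (simp add: D.sum D.scale)
qed

text \<open>In the chain rule the outer derivative is taken in the moving direction
  \<open>Dg x v\<close>; expanding that direction in the basis leaves products of functions to which
  the induction hypothesis applies.\<close>

lemma Ck_on_compose:
  fixes f :: "'b::euclidean_space \<Rightarrow> 'c::real_normed_vector" and g :: "'a::euclidean_space \<Rightarrow> 'b"
  assumes S: "open S" and T: "open T" and gST: "g ` S \<subseteq> T"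
  shows "Ck_on n f T \<Longrightarrow> Ck_on n g S \<Longrightarrow> Ck_on n (\<lambda>x. f (g x)) S"
proof (induction n arbitrary: f)
  case 0
  then show ?case using gST by (auto intro: continuous_on_compose2)
next
  case (Suc n)
  note f = Ck_on_SucD[OF Suc.prems(1)] and g = Ck_on_SucD[OF Suc.prems(2)]
  define Df where "Df x = frechet_derivative f (at x)" for x
  define Dg where "Dg x = frechet_derivative g (at x)" for x
  show ?case
  proof (rule Ck_on_SucI[OF S])
    fix x assume x: "x \<in> S"
    have "((\<lambda>x. f (g x)) has_derivative (\<lambda>v. Df (g x) (Dg x v))) (at x)"
      using has_derivative_compose[OF g(1)[OF x] f(1)] x gST unfolding Df_def Dg_def by blast
    also have "(\<lambda>v. Df (g x) (Dg x v)) = (\<lambda>v. \<Sum>b\<in>Basis. (Dg x v \<bullet> b) *\<^sub>R Df (g x) b)"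
      using has_derivative_basis_sum[OF f(1)] x gST unfolding Df_def by blast
    finally show "((\<lambda>x. f (g x)) has_derivative (\<lambda>v. \<Sum>b\<in>Basis. (Dg x v \<bullet> b) *\<^sub>R Df (g x) b)) (at x)" .
  next
    show "Ck_on n (\<lambda>x. \<Sum>b\<in>Basis. (Dg x v \<bullet> b) *\<^sub>R Df (g x) b) S" for v
    proof (intro Ck_on_sum[OF S] Ck_on_bilinear[OF S bounded_bilinear_scaleR])
      show "Ck_on n (\<lambda>x. Dg x v \<bullet> b) S" for b
        unfolding Dg_def by (rule Ck_on_linear[OF S bounded_linear_inner_left g(2)])
      show "Ck_on n (\<lambda>x. Df (g x) b) S" for b
        unfolding Df_def by (rule Suc.IH[OF f(2) Ck_on_less[OF S Suc.prems(2)]])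
    qed
  qed
qed

section \<open>Inverse function theorem in class \<open>C\<^sup>\<infinity>\<close>\<close>

text \<open>As r vanishes at x, r y is of order |y - x|, and its product with c y - c x, which tends
  to 0, has no first-order term. So continuity of c is enough, which permits differentiating the
  derivative of an inverse function while it is merely known to be continuous.\<close>

lemma has_derivative_mult_vanishing:
  fixes r :: "'a::real_normed_vector \<Rightarrow> real" and c :: "'a \<Rightarrow> 'b::real_normed_vector"
  assumes r: "(r has_derivative r') (at x)" and r0: "r x = 0" and c: "isCont c x"
  shows "((\<lambda>y. r y *\<^sub>R c y) has_derivative (\<lambda>v. r' v *\<^sub>R c x)) (at x)"
proof -
  have 1: "((\<lambda>y. r y *\<^sub>R c x) has_derivative (\<lambda>v. r' v *\<^sub>R c x)) (at x)"
    using r by (rule has_derivative_scaleR_left)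
  have 2: "((\<lambda>y. r y *\<^sub>R (c y - c x)) has_derivative (\<lambda>v. 0)) (at x)"
  proof -
    obtain e K where e: "e > 0" and K: "\<And>y. dist x y < e \<Longrightarrow> norm (r y) \<le> K * norm (y - x)"
    proof -
      obtain B where B: "\<And>v. norm (r' v) \<le> norm v * B"
        using bounded_linear.bounded[OF has_derivative_bounded_linear[OF r]] by blast
      obtain d where d: "d > 0" "\<And>y. norm (y - x) < d \<Longrightarrow> norm (r y - r x - r' (y - x)) \<le> 1 * norm (y - x)"
        using r unfolding has_derivative_at_alt by (metis zero_less_one)
      have "norm (r y) \<le> (B + 1) * norm (y - x)" if "dist x y < d" for y
        using d(2)[of y] B[of "y - x"] that r0 by (simp add: dist_norm norm_minus_commute algebra_simps)
      with d(1) show ?thesis using that by blast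
    qed
    have c0: "((\<lambda>y. norm (c y - c x)) \<longlongrightarrow> 0) (at x)"
      using c by (simp add: isCont_def LIM_zero tendsto_norm_zero)
    have t: "((\<lambda>y. norm (r y *\<^sub>R (c y - c x)) / norm (y - x)) \<longlongrightarrow> 0) (at x)"
    proof (rule Lim_null_comparison)
      show "((\<lambda>y. \<bar>K\<bar> * norm (c y - c x)) \<longlongrightarrow> 0) (at x)"
        using tendsto_mult_right_zero[OF c0] .
      have "norm (norm (r y *\<^sub>R (c y - c x)) / norm (y - x)) \<le> \<bar>K\<bar> * norm (c y - c x)"
        if "dist x y < e" "y \<noteq> x" for y
      proof -
        have "norm (r y) / norm (y - x) \<le> \<bar>K\<bar>"
          using K[OF that(1)] that(2) by (simp add: divide_simps) (meson abs_ge_self mult_right_mono norm_ge_zero order_trans)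
        then have "norm (r y) / norm (y - x) * norm (c y - c x) \<le> \<bar>K\<bar> * norm (c y - c x)"
          by (rule mult_right_mono) simp
        then show ?thesis by simp
      qed
      then show "\<forall>\<^sub>F y in at x. norm (norm (r y *\<^sub>R (c y - c x)) / norm (y - x)) \<le> \<bar>K\<bar> * norm (c y - c x)"
        unfolding eventually_at using e by (metis dist_commute)
    qed
    show ?thesis
    proof -
      have "((\<lambda>y. (1 / norm (y - x)) *\<^sub>R (r y *\<^sub>R (c y - c x))) \<longlongrightarrow> 0) (at x)"
        by (rule tendsto_norm_zero_cancel) (use t in simp)
      then show ?thesis
        unfolding has_derivative_at2 using r0 by simp
    qed
  qed
  show ?thesis
    using has_derivative_add[OF 1 2] by (simp add: algebra_simps)
qed

text \<open>The derivative of the inverse is G y, the inverse of the derivative F y of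
  \<open>f\<close> at g y. The derivative of y \<mapsto> G y v is a polynomial expression in G and
  in second derivatives of \<open>f\<close> at g y, so each class reached by g and G yields the next
  one.\<close>

lemma smooth_inverse_function:
  fixes f :: "'a::euclidean_space \<Rightarrow> 'a"
  assumes S: "open S" and f: "\<And>n. Ck_on n f S" and x0: "x0 \<in> S"
    and D: "(f has_derivative D) (at x0)" and inj: "inj D"
  obtains N V g where "open N" "N \<subseteq> S" "x0 \<in> N" "open V" "homeomorphism N V f g" "\<And>n. Ck_on n g V"
proof -
  define df where "df v x = frechet_derivative f (at x) v" for v x
  have df: "(f has_derivative (\<lambda>v. df v x)) (at x)" if "x \<in> S" for x
    using Ck_on_SucD(1)[OF f[of 1, unfolded One_nat_def] that] by (simp add: df_def)
  have Ck_df: "Ck_on n (df v) S" for n v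
    using Ck_on_SucD(2)[OF f[of "Suc n"]] by (simp add: df_def[abs_def])
  define f' where "f' x = Blinfun (\<lambda>v. df v x)" for x
  have f': "blinfun_apply (f' x) = (\<lambda>v. df v x)" if "x \<in> S" for x
    unfolding f'_def using df[OF that] by (intro bounded_linear_Blinfun_apply has_derivative_bounded_linear)
  have contf': "continuous_on S f'"
  proof (rule continuous_on_blinfun_componentwise)
    fix i :: 'a assume "i \<in> Basis"
    have "continuous_on S (df i)"
      using Ck_on_imp_continuous_on[OF S Ck_df[of 0 i]] .
    then show "continuous_on S (\<lambda>x. f' x i)"
      by (rule continuous_on_eq) (simp add: f')
  qed
  have lin: "linear (blinfun_apply (f' x0))" by (simp add: blinfun.bounded_linear_right bounded_linear.linear)
  have "inj (blinfun_apply (f' x0))"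
    using inj has_derivative_unique[OF D df[OF x0]] by (simp add: f' x0)
  then obtain iv where iv: "linear iv" "iv \<circ> blinfun_apply (f' x0) = id"
    using linear_injective_left_inverse[OF lin] by blast
  have left_inv: "Blinfun iv o\<^sub>L f' x0 = id_blinfun"
  proof (rule blinfun_eqI)
    fix v
    have "blinfun_apply (Blinfun iv) = iv"
      using iv(1) by (intro bounded_linear_Blinfun_apply) (simp add: linear_conv_bounded_linear)
    then show "(Blinfun iv o\<^sub>L f' x0) v = id_blinfun v"
      using iv(2) by (simp add: fun_eq_iff)
  qed
  have derf: "(f has_derivative blinfun_apply (f' x)) (at x)" if "x \<in> S" for x
    using df[OF that] by (simp add: f'[OF that])
  obtain N V g g' where N: "open N" "N \<subseteq> S" "x0 \<in> N" and V: "open V" "f x0 \<in> V"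
    and hom: "homeomorphism N V f g"
    and g': "\<And>y. y \<in> V \<Longrightarrow> (g has_derivative g' y) (at y)"
    and g'_inv: "\<And>y. y \<in> V \<Longrightarrow> g' y = inv_into UNIV (blinfun_apply (f' (g y)))"
    and bij: "\<And>y. y \<in> V \<Longrightarrow> bij (blinfun_apply (f' (g y)))"
    by (rule inverse_function_theorem[OF S derf contf' x0 left_inv]) (assumption, rule that)
  have gN: "g y \<in> N" if "y \<in> V" for y
    using hom that by (auto simp: homeomorphism_def)
  have gS: "g y \<in> S" if "y \<in> V" for y
    using gN[OF that] N by blast
  have contg: "continuous_on V g"
    using hom by (simp add: homeomorphism_def)
  define F where "F y = f' (g y)" for y
  define G where "G y = Blinfun (g' y)" for y
  have F: "F y v = df v (g y)" if "y \<in> V" for y v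
    using f'[OF gS[OF that]] by (simp add: F_def)
  have G: "blinfun_apply (G y) = g' y" if "y \<in> V" for y
    unfolding G_def using g'[OF that] by (intro bounded_linear_Blinfun_apply has_derivative_bounded_linear)
  have FG: "F y (G y v) = v" and GF: "G y (F y v) = v" if "y \<in> V" for y v
    using bij[OF that] unfolding G[OF that] g'_inv[OF that] F_def
    by (simp_all add: bij_is_surj surj_f_inv_f bij_is_inj)
  have contF: "continuous_on V F"
    unfolding F_def using gS by (intro continuous_on_compose2[OF contf' contg]) auto
  \<comment> \<open>Resolvent identity: G z - G y = G z (F y - F z) G y.\<close>
  have G_diff: "G z v - G y v = G z (F y (G y v) - F z (G y v))" if "y \<in> V" "z \<in> V" for y z v
    by (simp add: blinfun.diff_right FG GF that)
  have contG: "isCont (\<lambda>y. G y v) y" if y: "y \<in> V" for y v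
  proof -
    \<comment> \<open>Once |F z - F y| < 1 / (2 B), writing w = G y (F z w + (F y - F z) w) gives
      |w| \<le> B |F z w| + |w| / 2. Hence |G z| \<le> 2 B near y, and the resolvent identity yields
      continuity.\<close>
    define B where "B = norm (G y) + 1"
    have B: "B > 0" "norm (G y) \<le> B"
      by (auto simp: B_def add_nonneg_pos)
    have Fy: "isCont F y"
      using contF V(1) y continuous_on_eq_continuous_at by blast
    then have "\<forall>\<^sub>F z in at y. dist (F z) (F y) < 1 / (2 * B)"
      using B by (intro tendstoD) (auto simp: isCont_def)
    then have ev: "\<forall>\<^sub>F z in at y. norm (G z v - G y v) \<le> 2 * B * norm (F y (G y v) - F z (G y v))"
      using eventually_at_in_open'[OF V(1) y]
    proof eventually_elim
      case (elim z)
      have "norm (G z u) \<le> 2 * B * norm u" for u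
      proof -
        define w where "w = G z u"
        have u: "F z w = u" by (simp add: w_def FG elim)
        have "w = G y (F z w + (F y - F z) w)"
          by (simp add: blinfun.diff_left GF y)
        then have "norm w \<le> norm (G y) * norm (F z w + (F y - F z) w)"
          using norm_blinfun[of "G y" "F z w + (F y - F z) w"] by simp
        also have "\<dots> \<le> B * norm (F z w + (F y - F z) w)"
          using B(2) by (rule mult_right_mono) simp
        also have "\<dots> \<le> B * (norm u + norm (F y - F z) * norm w)"
          using B by (intro mult_left_mono) (auto simp: u norm_blinfun intro: order_trans[OF norm_triangle_ineq])
        also have "\<dots> \<le> B * (norm u + 1 / (2 * B) * norm w)"
          using B elim(1) by (intro mult_left_mono add_left_mono mult_right_mono)
            (simp_all add: dist_norm norm_minus_commute)
        also have "\<dots> = B * norm u + norm w / 2"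
          using B by (simp add: field_simps)
        finally show ?thesis unfolding w_def[symmetric] by simp
      qed
      then show ?case using G_diff[OF y, of z v] elim by metis
    qed
    have "((\<lambda>z. F z (G y v)) \<longlongrightarrow> F y (G y v)) (at y)"
      using Fy unfolding isCont_def by (intro blinfun.tendsto tendsto_const)
    then have "((\<lambda>z. F y (G y v) - F z (G y v)) \<longlongrightarrow> F y (G y v) - F y (G y v)) (at y)"
      by (intro tendsto_diff tendsto_const)
    then have "((\<lambda>z. 2 * B * norm (F y (G y v) - F z (G y v))) \<longlongrightarrow> 0) (at y)"
      by (intro tendsto_mult_right_zero tendsto_norm_zero) simp
    then have "((\<lambda>z. G z v - G y v) \<longlongrightarrow> 0) (at y)"
      using ev by (rule Lim_null_comparison[rotated])
    then show ?thesis by (simp add: isCont_def LIM_zero_cancel)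
  qed
  define H where "H b b' x = frechet_derivative (df b) (at x) b'" for b b' x
  have H: "(df b has_derivative (\<lambda>v. H b v x)) (at x)" if "x \<in> S" for b x
    using Ck_on_SucD(1)[OF Ck_df[of 1, unfolded One_nat_def] that] by (simp add: H_def)
  have Ck_H: "Ck_on n (H b b') S" for n b b'
    using Ck_on_SucD(2)[OF Ck_df[of "Suc n"]] by (simp add: H_def[abs_def])
  have df_sum: "df v x = (\<Sum>b\<in>Basis. (v \<bullet> b) *\<^sub>R df b x)" if "x \<in> S" for v x
    using has_derivative_basis_sum[OF df[OF that]] .
  \<comment> \<open>\<open>Q v w y\<close> is minus the second derivative of \<open>f\<close> at g y
    on the vectors G y v and G y w, in coordinates. The derivative of G y v in direction w is G y
    applied to it.\<close>
  define Q where "Q v w y = - (\<Sum>b\<in>Basis. (G y v \<bullet> b) *\<^sub>R (\<Sum>b'\<in>Basis. (G y w \<bullet> b') *\<^sub>R H b b' (g y)))" for v w y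
  have derG: "((\<lambda>y. G y v) has_derivative (\<lambda>w. \<Sum>c\<in>Basis. (Q v w y \<bullet> c) *\<^sub>R G y c)) (at y)"
    if y: "y \<in> V" for v y
  proof -
    \<comment> \<open>q z = (F y - F z) (G y v), so G z v = G y v + G z (q z) with q y = 0. This is
      the situation of \<open>has_derivative_mult_vanishing\<close>, with G z c as the continuous
      factor.\<close>
    define q where "q z = v - (\<Sum>b\<in>Basis. (G y v \<bullet> b) *\<^sub>R df b (g z))" for z
    have q: "q z = F y (G y v) - F z (G y v)" if "z \<in> V" for z
      unfolding F[OF that] FG[OF y] df_sum[OF gS[OF that], of "G y v"] q_def ..
    have q0: "q y = 0" using q[OF y] by simp
    have d1: "((\<lambda>z. df b (g z)) has_derivative (\<lambda>w. H b (g' y w) (g y))) (at y)" for b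
      using has_derivative_compose[OF g'[OF y] H[OF gS[OF y]]] .
    have d2: "H b (g' y w) (g y) = (\<Sum>b'\<in>Basis. (G y w \<bullet> b') *\<^sub>R H b b' (g y))" for b w
      unfolding G[OF y] by (rule has_derivative_basis_sum[OF H[OF gS[OF y]]])
    have dq: "(q has_derivative (\<lambda>w. Q v w y)) (at y)"
    proof -
      have "(q has_derivative (\<lambda>w. 0 - (\<Sum>b\<in>Basis. (G y v \<bullet> b) *\<^sub>R H b (g' y w) (g y)))) (at y)"
        unfolding q_def
        by (intro has_derivative_diff has_derivative_const has_derivative_sum has_derivative_scaleR_right d1)
      then show ?thesis by (simp only: Q_def d2 diff_0)
    qed
    have "((\<lambda>z. (q z \<bullet> c) *\<^sub>R G z c) has_derivative (\<lambda>w. (Q v w y \<bullet> c) *\<^sub>R G y c)) (at y)" for c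
      using q0 by (intro has_derivative_mult_vanishing has_derivative_inner_left dq contG y) simp
    then have "((\<lambda>z. G y v + (\<Sum>c\<in>Basis. (q z \<bullet> c) *\<^sub>R G z c)) has_derivative
        (\<lambda>w. 0 + (\<Sum>c\<in>Basis. (Q v w y \<bullet> c) *\<^sub>R G y c))) (at y)"
      by (intro has_derivative_add has_derivative_const has_derivative_sum)
    then have "((\<lambda>z. G y v + (\<Sum>c\<in>Basis. (q z \<bullet> c) *\<^sub>R G z c)) has_derivative
        (\<lambda>w. \<Sum>c\<in>Basis. (Q v w y \<bullet> c) *\<^sub>R G y c)) (at y)" by simp
    then show ?thesis
    proof (rule has_derivative_transform_within_open[OF _ V(1) y])
      fix z assume z: "z \<in> V"
      have "(\<Sum>c\<in>Basis. (q z \<bullet> c) *\<^sub>R G z c) = G z (\<Sum>c\<in>Basis. (q z \<bullet> c) *\<^sub>R c)"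
        by (simp add: blinfun.sum_right blinfun.scaleR_right)
      also have "\<dots> = G z v - G y v"
        by (simp only: euclidean_representation q[OF z] G_diff[OF y z])
      finally show "G y v + (\<Sum>c\<in>Basis. (q z \<bullet> c) *\<^sub>R G z c) = G z v"
        by simp
    qed
  qed
  \<comment> \<open>The two classes must rise together: the derivative of g is G, and that of G
    involves g through H.\<close>
  have "Ck_on n g V \<and> (\<forall>v. Ck_on n (\<lambda>y. G y v) V)" for n
  proof (induction n)
    case 0
    then show ?case using contg contG by (auto simp: continuous_at_imp_continuous_on)
  next
    case (Suc n)
    have g: "Ck_on n g V" and Gn: "Ck_on n (\<lambda>y. G y v) V" for v
      using Suc by auto
    have "Ck_on (Suc n) g V"
      by (rule Ck_on_SucI[OF V(1), of _ "\<lambda>y v. G y v"]) (use G g' Gn in auto)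
    moreover have "Ck_on (Suc n) (\<lambda>y. G y v) V" for v
    proof (rule Ck_on_SucI[OF V(1) derG])
      fix w
      have gST: "g ` V \<subseteq> S" using gS by auto
      have Q: "Ck_on n (Q v w) V"
        unfolding Q_def[abs_def]
        by (intro Ck_on_linear[OF V(1) bounded_linear_minus[OF bounded_linear_ident]] Ck_on_sum[OF V(1)]
            Ck_on_bilinear[OF V(1) bounded_bilinear_scaleR] Ck_on_linear[OF V(1) bounded_linear_inner_left]
            Gn Ck_on_compose[OF V(1) S gST Ck_H g])
      show "Ck_on n (\<lambda>y. \<Sum>c\<in>Basis. (Q v w y \<bullet> c) *\<^sub>R G y c) V"
        by (intro Ck_on_sum[OF V(1)]
            Ck_on_bilinear[OF V(1) bounded_bilinear_scaleR] Ck_on_linear[OF V(1) bounded_linear_inner_left]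
            Gn Q)
    qed
    ultimately show ?case by blast
  qed
  then show thesis
    using that N V(1) hom by blast
qed

section \<open>Symmetry of second derivatives\<close>

text \<open>The second difference of \<open>f\<close> over the parallelogram spanned by t u and t v
  is symmetric in u and v. Two applications of the mean value theorem turn it into t^2 times a mixed
  derivative at a point near x, in either order of differentiation, and continuity of the mixed
  derivatives does the rest.\<close>

lemma symmetric_second_derivative_real:
  fixes f :: "'a::euclidean_space \<Rightarrow> real"
  assumes S: "open S" and f: "Ck_on 2 f S" and x: "x \<in> S"
  shows "frechet_derivative (\<lambda>y. frechet_derivative f (at y) v) (at x) u =
    frechet_derivative (\<lambda>y. frechet_derivative f (at y) u) (at x) v"
proof -
  define d where "d v x = frechet_derivative f (at x) v" for v x
  define h where "h v u x = frechet_derivative (d v) (at x) u" for v u x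
  note f2 = f[unfolded numeral_2_eq_2]
  have d: "(f has_derivative (\<lambda>v. d v x)) (at x)" if "x \<in> S" for x
    using Ck_on_SucD(1)[OF f2 that] by (simp add: d_def)
  have Cd: "Ck_on (Suc 0) (d v) S" for v
    using Ck_on_SucD(2)[OF f2] by (simp add: d_def[abs_def])
  have h: "(d v has_derivative (\<lambda>u. h v u x)) (at x)" if "x \<in> S" for x v
    using Ck_on_SucD(1)[OF Cd that] by (simp add: h_def)
  have conth: "continuous_on S (h v u)" for v u
    using Ck_on_SucD(2)[OF Cd] by (simp add: h_def[abs_def])
  have mvt: "\<exists>y. dist x y < e \<and> y \<in> S \<and>
      f (x + t *\<^sub>R u + t *\<^sub>R v) - f (x + t *\<^sub>R u) - f (x + t *\<^sub>R v) + f x = t\<^sup>2 * h u v y"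
    if t: "t > 0" and te: "t * (norm u + norm v) < e" and ball: "ball x e \<subseteq> S" for t e u v
  proof -
    have near: "dist x (x + a *\<^sub>R u + b *\<^sub>R v) < e" if "0 \<le> a" "a \<le> t" "0 \<le> b" "b \<le> t" for a b
    proof -
      have "norm (a *\<^sub>R u + b *\<^sub>R v) \<le> a * norm u + b * norm v"
        using that by (intro order_trans[OF norm_triangle_ineq]) auto
      also have "\<dots> \<le> t * norm u + t * norm v"
        using that by (intro add_mono mult_right_mono) auto
      also have "\<dots> < e" using te by (simp add: distrib_left)
      finally have "norm (a *\<^sub>R u + b *\<^sub>R v) < e" .
      moreover have "x - (x + a *\<^sub>R u + b *\<^sub>R v) = - (a *\<^sub>R u + b *\<^sub>R v)" by simp
      ultimately show ?thesis by (simp only: dist_norm norm_minus_cancel)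
    qed
    then have inS: "x + a *\<^sub>R u + b *\<^sub>R v \<in> S" if "0 \<le> a" "a \<le> t" "0 \<le> b" "b \<le> t" for a b
      using ball that by auto
    define P where "P a = f (x + a *\<^sub>R u + t *\<^sub>R v) - f (x + a *\<^sub>R u + 0 *\<^sub>R v)" for a
    define P' where "P' a = d u (x + a *\<^sub>R u + t *\<^sub>R v) - d u (x + a *\<^sub>R u + 0 *\<^sub>R v)" for a
    have "(P has_derivative (\<lambda>s. s * P' a)) (at a)" if a: "0 \<le> a" "a \<le> t" for a
    proof -
      have 1: "((\<lambda>a. f (x + a *\<^sub>R u + b *\<^sub>R v)) has_derivative (\<lambda>s. s * d u (x + a *\<^sub>R u + b *\<^sub>R v))) (at a)"
        if b: "0 \<le> b" "b \<le> t" for b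
      proof -
        have "((\<lambda>a. x + a *\<^sub>R u + b *\<^sub>R v) has_derivative (\<lambda>s. s *\<^sub>R u)) (at a)"
          by (auto intro!: derivative_eq_intros)
        from has_derivative_compose[OF this d[OF inS[OF a b]]]
        show ?thesis
          by (simp only: linear_cmul[OF has_derivative_linear[OF d[OF inS[OF a b]]]] real_scaleR_def)
      qed
      show ?thesis
        unfolding P_def P'_def right_diff_distrib using t by (intro has_derivative_diff 1) auto
    qed
    then have "\<exists>a\<in>{0<..<t}. P t - P 0 = (t - 0) * P' a"
      by (intro mvt_simple[OF t]) (auto dest: has_derivative_at_withinI)
    then obtain a where a: "0 < a" "a < t" "P t - P 0 = (t - 0) * P' a"
      by auto
    define R where "R b = d u (x + a *\<^sub>R u + b *\<^sub>R v)" for b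
    have "(R has_derivative (\<lambda>s. s * h u v (x + a *\<^sub>R u + b *\<^sub>R v))) (at b)" if b: "0 \<le> b" "b \<le> t" for b
    proof -
      have line: "((\<lambda>b. x + a *\<^sub>R u + b *\<^sub>R v) has_derivative (\<lambda>s. s *\<^sub>R v)) (at b)"
        by (auto intro!: derivative_eq_intros)
      note hab = h[OF inS[OF less_imp_le[OF a(1)] less_imp_le[OF a(2)] b], of u]
      from has_derivative_compose[OF line hab]
      show ?thesis
        unfolding R_def by (simp only: linear_cmul[OF has_derivative_linear[OF hab]] real_scaleR_def)
    qed
    then have "\<exists>b\<in>{0<..<t}. R t - R 0 = (t - 0) * h u v (x + a *\<^sub>R u + b *\<^sub>R v)"
      by (intro mvt_simple[OF t]) (auto dest: has_derivative_at_withinI)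
    then obtain b where b: "0 < b" "b < t" "R t - R 0 = (t - 0) * h u v (x + a *\<^sub>R u + b *\<^sub>R v)"
      by auto
    have "f (x + t *\<^sub>R u + t *\<^sub>R v) - f (x + t *\<^sub>R u) - f (x + t *\<^sub>R v) + f x = P t - P 0"
      by (simp add: P_def)
    also have "\<dots> = t\<^sup>2 * h u v (x + a *\<^sub>R u + b *\<^sub>R v)"
      using a(3) b(3) by (simp add: P'_def R_def power2_eq_square)
    finally show ?thesis
      using near[of a b] inS[of a b] a b by (intro exI[of _ "x + a *\<^sub>R u + b *\<^sub>R v"]) auto
  qed
  have "h u v x = h v u x"
  proof (rule ccontr)
    assume ne: "h u v x \<noteq> h v u x"
    \<comment> \<open>Half the supposed gap: two values within this distance of the two mixed
      derivatives at x cannot coincide, yet the second difference makes them equal.\<close>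
    define \<epsilon> where "\<epsilon> = \<bar>h u v x - h v u x\<bar> / 2"
    have \<epsilon>: "\<epsilon> > 0" using ne by (simp add: \<epsilon>_def)
    have cont: "isCont (h u v) x" "isCont (h v u) x"
      using conth S x continuous_on_eq_continuous_at by blast+
    obtain e1 where e1: "e1 > 0" "\<And>y. dist x y < e1 \<Longrightarrow> dist (h u v x) (h u v y) < \<epsilon>"
      using cont(1) \<epsilon> unfolding continuous_at_eps_delta by (metis dist_commute)
    obtain e2 where e2: "e2 > 0" "\<And>y. dist x y < e2 \<Longrightarrow> dist (h v u x) (h v u y) < \<epsilon>"
      using cont(2) \<epsilon> unfolding continuous_at_eps_delta by (metis dist_commute)
    obtain e3 where e3: "e3 > 0" "ball x e3 \<subseteq> S" using S x openE by blast
    define e where "e = min e1 (min e2 e3)"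
    have e: "e > 0" "ball x e \<subseteq> S" "e \<le> e1" "e \<le> e2"
      using e1 e2 e3 by (auto simp: e_def)
    \<comment> \<open>The summand 1 keeps K positive when u = v = 0; then t K = e / 2 keeps the
      parallelogram inside the ball.\<close>
    define K where "K = norm u + norm v + 1"
    define t where "t = e / (2 * K)"
    have K: "K > 0" "norm u + norm v \<le> K" by (auto simp: K_def add_nonneg_pos)
    have t: "t > 0" using K e by (simp add: t_def)
    have "t * (norm u + norm v) \<le> t * K" using K t by simp
    also have "\<dots> < e" using K e by (simp add: t_def)
    finally have te: "t * (norm u + norm v) < e" "t * (norm v + norm u) < e" by (simp_all add: add.commute)
    obtain y where y: "dist x y < e"
      "f (x + t *\<^sub>R u + t *\<^sub>R v) - f (x + t *\<^sub>R u) - f (x + t *\<^sub>R v) + f x = t\<^sup>2 * h u v y"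
      using mvt[OF t te(1) e(2)] by blast
    obtain z where z: "dist x z < e"
      "f (x + t *\<^sub>R v + t *\<^sub>R u) - f (x + t *\<^sub>R v) - f (x + t *\<^sub>R u) + f x = t\<^sup>2 * h v u z"
      using mvt[OF t te(2) e(2)] by blast
    have "t\<^sup>2 * h u v y = t\<^sup>2 * h v u z"
      using y(2) z(2) add.commute[of "t *\<^sub>R u" "t *\<^sub>R v"] by (simp only: add.assoc)
    then have "h u v y = h v u z" using t by simp
    moreover have "dist (h u v x) (h u v y) < \<epsilon>" "dist (h v u x) (h v u z) < \<epsilon>"
      using e1(2) e2(2) y(1) z(1) e by auto
    ultimately show False
      using dist_triangle2[of "h u v x" "h v u x" "h u v y"] by (simp add: \<epsilon>_def dist_real_def)
  qed
  then show ?thesis by (simp add: h_def d_def[abs_def])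
qed

lemma symmetric_second_derivative:
  fixes f :: "'a::euclidean_space \<Rightarrow> 'b::euclidean_space"
  assumes S: "open S" and f: "Ck_on 2 f S" and x: "x \<in> S"
  shows "frechet_derivative (\<lambda>y. frechet_derivative f (at y) v) (at x) u =
    frechet_derivative (\<lambda>y. frechet_derivative f (at y) u) (at x) v"
proof (rule euclidean_eqI)
  fix b :: 'b
  note f2 = f[unfolded numeral_2_eq_2]
  have 1: "frechet_derivative (\<lambda>z. f z \<bullet> b) (at y) w = frechet_derivative f (at y) w \<bullet> b" if "y \<in> S" for y w
    using frechet_derivative_at[OF has_derivative_inner_left[OF Ck_on_SucD(1)[OF f2 that], of b]]
    by (metis)
  have 2: "frechet_derivative (\<lambda>y. frechet_derivative (\<lambda>z. f z \<bullet> b) (at y) w) (at x) w' =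
      frechet_derivative (\<lambda>y. frechet_derivative f (at y) w) (at x) w' \<bullet> b" for w w'
  proof -
    have "((\<lambda>y. frechet_derivative f (at y) w \<bullet> b) has_derivative
        (\<lambda>w'. frechet_derivative (\<lambda>y. frechet_derivative f (at y) w) (at x) w' \<bullet> b)) (at x)"
      by (rule has_derivative_inner_left[OF Ck_on_SucD(1)[OF Ck_on_SucD(2)[OF f2] x]])
    then have "((\<lambda>y. frechet_derivative (\<lambda>z. f z \<bullet> b) (at y) w) has_derivative
        (\<lambda>w'. frechet_derivative (\<lambda>y. frechet_derivative f (at y) w) (at x) w' \<bullet> b)) (at x)"
      by (rule has_derivative_transform_within_open[OF _ S x]) (simp add: 1)
    then show ?thesis using frechet_derivative_at by metis
  qed
  show "frechet_derivative (\<lambda>y. frechet_derivative f (at y) v) (at x) u \<bullet> b =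
      frechet_derivative (\<lambda>y. frechet_derivative f (at y) u) (at x) v \<bullet> b"
    using symmetric_second_derivative_real[OF S Ck_on_linear[OF S bounded_linear_inner_left f] x, of b v u]
    by (simp add: 2)
qed

section \<open>Constant forms on a submanifold\<close>

text \<open>\<open>dir_deriv\<close> looks along the line y + t v, which stays in L and, for small
  t, in V. So the derivative of a smooth extension F may be used although \<open>f\<close> is
  uncontrolled off L.\<close>

lemma dir_deriv_on_subspace:
  assumes L: "subspace L" and V: "open V" and y: "y \<in> V" "y \<in> L" and v: "v \<in> L"
    and eq: "\<And>z. z \<in> L \<inter> V \<Longrightarrow> f z = F z" and F: "(F has_derivative D) (at y)"
  shows "dir_deriv f y v = D v"
proof -
  have lin: "((\<lambda>t. y + t *\<^sub>R v) has_derivative (\<lambda>t. t *\<^sub>R v)) (at 0)"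
    by (auto intro!: derivative_eq_intros)
  have "((\<lambda>t. F (y + t *\<^sub>R v)) has_derivative (\<lambda>t. D (t *\<^sub>R v))) (at 0)"
    by (rule has_derivative_compose[OF lin]) (simp add: F)
  then have "((\<lambda>t. F (y + t *\<^sub>R v)) has_vector_derivative D v) (at 0)"
    unfolding has_vector_derivative_def by (simp only: linear_cmul[OF has_derivative_linear[OF F]])
  moreover have op: "open ((\<lambda>t::real. y + t *\<^sub>R v) -` V)"
    by (intro open_vimage V continuous_intros)
  ultimately have "((\<lambda>t. f (y + t *\<^sub>R v)) has_vector_derivative D v) (at 0)"
    by (rule has_vector_derivative_transform_within_open)
      (use y v L eq in \<open>auto simp: subspace_add subspace_scale\<close>)
  then show ?thesis
    unfolding dir_deriv_def by (rule vector_derivative_at)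
qed

lemma local_param_extension:
  assumes "local_param M L Q \<psi>" "x \<in> Q"
  obtains V F where "open V" "x \<in> V" "\<And>n. Ck_on n F V" "Q \<inter> V = L \<inter> V" "\<And>y. y \<in> L \<inter> V \<Longrightarrow> \<psi> y = F y"
proof -
  obtain W F where W: "open W" "x \<in> W" "\<And>n. Ck_on n F W" "\<And>y. y \<in> Q \<inter> W \<Longrightarrow> F y = \<psi> y"
    using assms unfolding local_param_def smooth_on_def by blast
  obtain T where T: "open T" "Q = L \<inter> T"
    using assms unfolding local_param_def by (auto simp: openin_open)
  show thesis
    by (rule that[of "W \<inter> T" F]) (use W T assms(2) in \<open>auto intro: Ck_on_subset\<close>)
qed

lemma pullback_constant_form:
  fixes \<omega> :: "'g::euclidean_space \<Rightarrow> 'g \<Rightarrow> real"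
  assumes \<psi>: "local_param M L Q \<psi>" and V: "open V" "Q \<inter> V = L \<inter> V"
    and F: "\<And>n. Ck_on n F V" "\<And>y. y \<in> L \<inter> V \<Longrightarrow> \<psi> y = F y"
    and y: "y \<in> L \<inter> V" and v: "v \<in> L" and w: "w \<in> L"
  shows "pullback_form \<psi> (\<lambda>p. \<omega>) y v w =
    \<omega> (frechet_derivative F (at y) v) (frechet_derivative F (at y) w)"
proof -
  have L: "subspace L" using \<psi> by (simp add: local_param_def)
  have D: "(F has_derivative frechet_derivative F (at y)) (at y)"
    using Ck_on_SucD(1)[OF F(1)[of "Suc 0"]] y by auto
  show ?thesis
    unfolding pullback_form_def
    using dir_deriv_on_subspace[OF L V(1) _ _ v F(2) D] dir_deriv_on_subspace[OF L V(1) _ _ w F(2) D] y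
    by auto
qed

lemma two_form_on_constant:
  fixes \<omega> :: "'g::euclidean_space \<Rightarrow> 'g \<Rightarrow> real"
  assumes \<omega>: "bounded_bilinear \<omega>" and anti: "\<And>v w. \<omega> v w = - \<omega> w v"
  shows "two_form_on M (\<lambda>p. \<omega>)"
proof -
  interpret \<omega>: bounded_bilinear \<omega> by (rule \<omega>)
  have "smooth_on Q (\<lambda>x. pullback_form \<psi> (\<lambda>p. \<omega>) x v w)"
    if \<psi>: "local_param M L Q \<psi>" and v: "v \<in> L" and w: "w \<in> L" for L Q \<psi> v w
    unfolding smooth_on_def
  proof
    fix x assume "x \<in> Q"
    from local_param_extension[OF \<psi> this] obtain V F where V: "open V" "x \<in> V" and F: "\<And>n. Ck_on n F V"
      and QV: "Q \<inter> V = L \<inter> V" and eq: "\<And>y. y \<in> L \<inter> V \<Longrightarrow> \<psi> y = F y" by metis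
    define G where "G y = \<omega> (frechet_derivative F (at y) v) (frechet_derivative F (at y) w)" for y
    have "Ck_on n G V" for n
      unfolding G_def[abs_def] by (intro Ck_on_bilinear[OF V(1) \<omega>] Ck_on_SucD(2)[OF F])
    moreover have "G y = pullback_form \<psi> (\<lambda>p. \<omega>) y v w" if "y \<in> Q \<inter> V" for y
      using pullback_constant_form[OF \<psi> V(1) QV F eq _ v w] that QV by (simp add: G_def)
    ultimately show "\<exists>V F. open V \<and> x \<in> V \<and> (\<forall>n. Ck_on n F V) \<and>
        (\<forall>y\<in>Q \<inter> V. F y = pullback_form \<psi> (\<lambda>p. \<omega>) y v w)"
      using V by blast
  qed
  then show ?thesis
    unfolding two_form_on_def by (intro conjI ballI allI anti impI) (simp_all add: \<omega>.add_left \<omega>.scaleR_left)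
qed

text \<open>Differentiating a pulled-back constant form by the product rule gives six terms, each
  pairing a first with a second derivative of the parametrization. Symmetry of second derivatives
  and antisymmetry of \<omega> cancel them in pairs.\<close>

lemma closed_form_on_constant:
  fixes \<omega> :: "'g::euclidean_space \<Rightarrow> 'g \<Rightarrow> real"
  assumes \<omega>: "bounded_bilinear \<omega>" and anti: "\<And>v w. \<omega> v w = - \<omega> w v"
  shows "closed_form_on M (\<lambda>p. \<omega>)"
  unfolding closed_form_on_def
proof (intro allI impI ballI)
  fix L Q \<psi> x u v w
  assume \<psi>: "local_param M L Q \<psi>" and x: "x \<in> Q" and u: "u \<in> L" and v: "v \<in> L" and w: "w \<in> L"
  have L: "subspace L" using \<psi> by (simp add: local_param_def)
  from local_param_extension[OF \<psi> x] obtain V F where V: "open V" "x \<in> V" and F: "\<And>n. Ck_on n F V"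
    and QV: "Q \<inter> V = L \<inter> V" and eq: "\<And>y. y \<in> L \<inter> V \<Longrightarrow> \<psi> y = F y" by metis
  have xL: "x \<in> L" using x V QV by auto
  define d where "d v y = frechet_derivative F (at y) v" for v y
  define h where "h v u = frechet_derivative (d v) (at x) u" for v u
  have d: "(d v has_derivative h v) (at x)" for v
    using Ck_on_SucD(1)[OF Ck_on_SucD(2)[OF F[of "Suc (Suc 0)"]] V(2)] unfolding d_def[abs_def] h_def[abs_def] .
  have sym: "h v u = h u v" for u v
    using symmetric_second_derivative[OF V(1) F V(2)] unfolding d_def[abs_def] h_def .
  have D: "dir_deriv (\<lambda>y. pullback_form \<psi> (\<lambda>p. \<omega>) y v w) x u = \<omega> (d v x) (h w u) + \<omega> (h v u) (d w x)"
    if u: "u \<in> L" and v: "v \<in> L" and w: "w \<in> L" for u v w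
  proof (rule dir_deriv_on_subspace[OF L V xL u])
    show "((\<lambda>y. \<omega> (d v y) (d w y)) has_derivative (\<lambda>u. \<omega> (d v x) (h w u) + \<omega> (h v u) (d w x))) (at x)"
      by (rule bounded_bilinear.FDERIV[OF \<omega> d d])
    show "pullback_form \<psi> (\<lambda>p. \<omega>) z v w = \<omega> (d v z) (d w z)" if "z \<in> L \<inter> V" for z
      unfolding d_def by (rule pullback_constant_form[OF \<psi> V(1) QV F eq that v w])
  qed
  show "dir_deriv (\<lambda>y. pullback_form \<psi> (\<lambda>p. \<omega>) y v w) x u
      - dir_deriv (\<lambda>y. pullback_form \<psi> (\<lambda>p. \<omega>) y u w) x v
      + dir_deriv (\<lambda>y. pullback_form \<psi> (\<lambda>p. \<omega>) y u v) x w = 0"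
    unfolding D[OF u v w] D[OF v u w] D[OF w u v] sym[of v u] sym[of w u] sym[of w v]
    using anti[of "d v x" "h u w"] by linarith
qed

section \<open>Submanifold charts and tangent vectors\<close>

text \<open>A diffeomorphism of open sets of the ambient space that carries L to M supplies both
  smooth extensions at once, \<open>f\<close> for the parametrization and \<open>g\<close> for its
  inverse.\<close>

lemma local_param_of_diffeo:
  assumes "open N" "open V" and hom: "homeomorphism N V f g"
    and f: "\<And>n. Ck_on n f N" and g: "\<And>n. Ck_on n g V"
    and L: "subspace L" and M: "M \<inter> V = f ` (L \<inter> N)"
  shows "local_param M L (L \<inter> N) f"
  unfolding local_param_def
proof (intro conjI L)
  have gf: "g (f x) = x" if "x \<in> N" for x using hom that by (auto simp: homeomorphism_def)
  show "openin (top_of_set L) (L \<inter> N)" using assms(1) by (rule openin_open_Int)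
  show "openin (top_of_set M) (f ` (L \<inter> N))" using assms(2) unfolding M[symmetric] by (rule openin_open_Int)
  show inj: "inj_on f (L \<inter> N)" by (rule inj_on_inverseI[of _ g]) (auto simp: gf)
  show "smooth_on (L \<inter> N) f" using assms(1) f by (auto simp: smooth_on_def)
  have "g y = inv_into (L \<inter> N) f y" if "y \<in> f ` (L \<inter> N)" for y
    using that by (auto simp: gf inv_into_f_f[OF inj])
  then show "smooth_on (f ` (L \<inter> N)) (inv_into (L \<inter> N) f)"
    unfolding smooth_on_def M[symmetric] using assms(2) g by (intro ballI exI[of _ V] exI[of _ g]) auto
qed

text \<open>As A and its inverse B both map M into itself, A carries M \<inter> V onto M \<inter> A
  V. This moves a single chart to every point reached by such symmetries.\<close>

lemma local_param_linear_image:
  fixes f g A B :: "'g::euclidean_space \<Rightarrow> 'g"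
  assumes N: "open N" and V: "open V" and hom: "homeomorphism N V f g"
    and f: "\<And>n. Ck_on n f N" and g: "\<And>n. Ck_on n g V"
    and L: "subspace L" and M: "M \<inter> V = f ` (L \<inter> N)"
    and A: "linear A" and B: "linear B" and AB: "\<And>x. A (B x) = x" and BA: "\<And>x. B (A x) = x"
    and AM: "A ` M \<subseteq> M" and BM: "B ` M \<subseteq> M"
  shows "local_param M L (L \<inter> N) (\<lambda>x. A (f x))"
proof (rule local_param_of_diffeo[OF N _ _ _ _ L])
  have blA: "bounded_linear A" and blB: "bounded_linear B"
    using A B by (simp_all add: linear_conv_bounded_linear)
  have eq: "A ` V = B -` V"
  proof
    show "B -` V \<subseteq> A ` V" using AB by (metis image_eqI subsetI vimageE)
  qed (auto simp: BA)
  show op: "open (A ` V)"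
    unfolding eq by (rule open_vimage[OF V linear_continuous_on[OF blB]])
  show "Ck_on n (\<lambda>x. A (f x)) N" for n
    by (rule Ck_on_linear[OF N blA f])
  have "Ck_on n B (A ` V)" for n
    by (rule Ck_on_linear[OF op blB Ck_on_ident[OF op]])
  then show "Ck_on n (\<lambda>y. g (B y)) (A ` V)" for n
    by (intro Ck_on_compose[OF op V _ g]) (auto simp: BA)
  show "homeomorphism N (A ` V) (\<lambda>x. A (f x)) (\<lambda>y. g (B y))"
  proof -
    have "homeomorphism V (A ` V) A B"
      unfolding homeomorphism_def
      using linear_continuous_on[OF blA] linear_continuous_on[OF blB] by (auto simp: AB BA image_image)
    then show ?thesis
      using homeomorphism_compose[OF hom] by (simp add: o_def)
  qed
  have "A ` (M \<inter> V) = M \<inter> A ` V"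
  proof
    show "M \<inter> A ` V \<subseteq> A ` (M \<inter> V)"
    proof
      fix y assume y: "y \<in> M \<inter> A ` V"
      then have "B y \<in> M \<inter> V" using BM BA by auto
      then show "y \<in> A ` (M \<inter> V)" using AB[of y] by force
    qed
  qed (use AM in auto)
  then show "M \<inter> A ` V = (\<lambda>x. A (f x)) ` (L \<inter> N)"
    by (simp add: M image_image)
qed

lemma tangent_space_linear_image:
  assumes A: "linear A" and AM: "A ` M \<subseteq> M" and v: "v \<in> tangent_space M p"
  shows "A v \<in> tangent_space M (A p)"
proof -
  have bl: "bounded_linear A" using A by (simp add: linear_conv_bounded_linear)
  obtain \<gamma> e where \<gamma>: "e > 0" "smooth_on {-e<..<e::real} \<gamma>" "\<gamma> ` {-e<..<e} \<subseteq> M" "\<gamma> 0 = p"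
    "(\<gamma> has_vector_derivative v) (at 0)"
    using v by (auto simp: tangent_space_def)
  have "smooth_on {-e<..<e} (\<lambda>t. A (\<gamma> t))"
    unfolding smooth_on_def
  proof
    fix t assume "t \<in> {-e<..<e}"
    then obtain V F where V: "open V" "t \<in> V" "\<And>n. Ck_on n F V" "\<And>y. y \<in> {-e<..<e} \<inter> V \<Longrightarrow> F y = \<gamma> y"
      using \<gamma>(2) unfolding smooth_on_def by metis
    then show "\<exists>V F. open V \<and> t \<in> V \<and> (\<forall>n. Ck_on n F V) \<and> (\<forall>y\<in>{-e<..<e} \<inter> V. F y = A (\<gamma> y))"
      by (intro exI[of _ V] exI[of _ "\<lambda>t. A (F t)"]) (auto intro: Ck_on_linear[OF V(1) bl])
  qed
  moreover have "((\<lambda>t. A (\<gamma> t)) has_vector_derivative A v) (at 0)"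
    using \<gamma>(5) by (rule bounded_linear.has_vector_derivative[OF bl])
  moreover have "(\<lambda>t. A (\<gamma> t)) ` {-e<..<e} \<subseteq> M" "A (\<gamma> 0) = A p"
    using \<gamma> AM by auto
  ultimately show ?thesis
    unfolding tangent_space_def using \<gamma>(1) by blast
qed

text \<open>A curve in M through f x is f applied to the curve g (\<gamma> t), which runs in L. The
  difference quotients of the latter lie in L, which is closed, so its velocity does too.\<close>

lemma tangent_space_chart:
  fixes f g :: "'g::euclidean_space \<Rightarrow> 'g"
  assumes V: "open V" and hom: "homeomorphism N V f g" and g: "Ck_on 1 g V" and N: "open N"
    and L: "subspace L" and M: "M \<inter> V = f ` (L \<inter> N)" and x: "x \<in> N"
    and D: "(f has_derivative D) (at x)" and v: "v \<in> tangent_space M (f x)"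
  shows "v \<in> D ` L"
proof -
  obtain \<gamma> e where \<gamma>: "e > 0" "\<gamma> ` {-e<..<e::real} \<subseteq> M" "\<gamma> 0 = f x"
    "(\<gamma> has_vector_derivative v) (at 0)"
    using v by (auto simp: tangent_space_def)
  have fV: "f x \<in> V" and gf: "\<And>y. y \<in> N \<Longrightarrow> g (f y) = y" and fg: "\<And>y. y \<in> V \<Longrightarrow> f (g y) = y"
    using hom x by (auto simp: homeomorphism_def)
  define G where "G = frechet_derivative g (at (f x))"
  have G: "(g has_derivative G) (at (f x))"
    unfolding G_def using Ck_on_SucD(1)[OF g[unfolded One_nat_def] fV] .
  have "\<forall>\<^sub>F t in at 0. \<gamma> t \<in> V"
    using has_vector_derivative_continuous[OF \<gamma>(4)] V fV \<gamma>(3)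
    unfolding continuous_within by (simp add: topological_tendstoD)
  moreover have "\<forall>\<^sub>F t in at (0::real). t \<in> {-e<..<e}"
    using \<gamma>(1) by (intro eventually_at_in_open') auto
  ultimately have ev: "\<forall>\<^sub>F t in at 0. g (\<gamma> t) \<in> L \<and> f (g (\<gamma> t)) = \<gamma> t"
  proof eventually_elim
    case (elim t)
    then have "\<gamma> t \<in> M \<inter> V" using \<gamma>(2) by auto
    then obtain y where "y \<in> L \<inter> N" "\<gamma> t = f y" unfolding M by auto
    then show ?case using gf fg elim by auto
  qed
  define w where "w = G v"
  have g\<gamma>: "((\<lambda>t. g (\<gamma> t)) has_vector_derivative w) (at 0)"
  proof -
    have "((\<lambda>t. g (\<gamma> t)) has_derivative (\<lambda>t. G (t *\<^sub>R v))) (at 0)"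
      by (rule has_derivative_compose[OF \<gamma>(4)[unfolded has_vector_derivative_def]]) (simp only: \<gamma>(3) G)
    then show ?thesis
      unfolding has_vector_derivative_def w_def by (simp only: linear_cmul[OF has_derivative_linear[OF G]])
  qed
  \<comment> \<open>That x lies in L is not assumed: it follows because the curve shows f x to be in
    M.\<close>
  have "f x \<in> f ` (L \<inter> N)"
  proof -
    have "\<gamma> 0 \<in> M" using \<gamma>(1,2) by (auto simp: image_subset_iff)
    then show ?thesis using \<gamma>(3) fV unfolding M[symmetric] by simp
  qed
  then obtain x' where "x' \<in> L \<inter> N" "f x = f x'" by blast
  then have xL: "x \<in> L"
    using gf[of x'] gf[OF x] by simp
  have "w \<in> L"
  proof (rule Lim_in_closed_set)
    show "closed L" using L by (rule closed_subspace)
    show "((\<lambda>t. (1 / t) *\<^sub>R (g (\<gamma> t) - x)) \<longlongrightarrow> w) (at (0::real))"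
    proof -
      have "((\<lambda>t. norm ((1 / norm (t - 0)) *\<^sub>R (g (\<gamma> t) - (g (\<gamma> 0) + (t - 0) *\<^sub>R w)))) \<longlongrightarrow> 0) (at 0)"
        using g\<gamma> unfolding has_vector_derivative_def has_derivative_at2 by (intro tendsto_norm_zero) simp
      moreover have "\<forall>\<^sub>F t in at 0. norm ((1 / norm (t - 0)) *\<^sub>R (g (\<gamma> t) - (g (\<gamma> 0) + (t - 0) *\<^sub>R w))) =
          norm ((1 / t) *\<^sub>R (g (\<gamma> t) - x) - w)"
        unfolding eventually_at
      proof (intro exI[of _ 1] conjI ballI impI)
        fix t :: real assume "t \<noteq> 0 \<and> dist t 0 < 1"
        then have "(1 / t) *\<^sub>R (g (\<gamma> t) - x) - w = (1 / t) *\<^sub>R (g (\<gamma> t) - (x + t *\<^sub>R w))"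
          by (simp add: scaleR_diff_right scaleR_add_right)
        then show "norm ((1 / norm (t - 0)) *\<^sub>R (g (\<gamma> t) - (g (\<gamma> 0) + (t - 0) *\<^sub>R w))) =
            norm ((1 / t) *\<^sub>R (g (\<gamma> t) - x) - w)"
          by (simp add: \<gamma>(3) gf[OF x])
      qed simp
      ultimately have "((\<lambda>t. norm ((1 / t) *\<^sub>R (g (\<gamma> t) - x) - w)) \<longlongrightarrow> 0) (at 0)"
        by (rule Lim_transform_eventually)
      then show ?thesis
        by (rule LIM_zero_cancel[OF tendsto_norm_zero_cancel])
    qed
    show "\<forall>\<^sub>F t in at 0. (1 / t) *\<^sub>R (g (\<gamma> t) - x) \<in> L"
      using ev by eventually_elim (use L xL in \<open>auto intro: subspace_scale subspace_diff\<close>)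
  qed simp
  moreover have "D w = v"
  proof -
    have "((\<lambda>t. f (g (\<gamma> t))) has_derivative (\<lambda>t. D (t *\<^sub>R w))) (at 0)"
      by (rule has_derivative_compose[OF g\<gamma>[unfolded has_vector_derivative_def]])
        (simp only: \<gamma>(3) gf[OF x] D)
    then have "((\<lambda>t. f (g (\<gamma> t))) has_vector_derivative D w) (at 0)"
      unfolding has_vector_derivative_def by (simp only: linear_cmul[OF has_derivative_linear[OF D]])
    moreover have "\<forall>\<^sub>F t in nhds 0. f (g (\<gamma> t)) = \<gamma> t"
      unfolding eventually_nhds_conv_at using ev \<gamma>(3) gf[OF x] by (simp add: eventually_conj_iff)
    ultimately have "(\<gamma> has_vector_derivative D w) (at 0)"
      by (subst (asm) has_vector_derivative_cong_ev[where g = \<gamma> and S = UNIV]) (auto simp: \<gamma>(3) gf[OF x])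
    then show ?thesis
      using \<gamma>(4) by (rule vector_derivative_unique_at)
  qed
  ultimately show ?thesis by blast
qed

section \<open>Traces and the Killing form of a compact real form\<close>

context vector_space begin

text \<open>Expanding both sides gives the same double sum of matrix entries. Allowing two bases
  serves two ends: with the identity for g it yields independence of the trace from the basis, with
  B = C it yields cyclicity.\<close>

lemma trace_swap:
  assumes B: "independent B" "finite B" and C: "independent C" "finite C"
    and f: "Vector_Spaces.linear scale scale f" and g: "Vector_Spaces.linear scale scale g"
    and gB: "\<And>b. b \<in> B \<Longrightarrow> g b \<in> span C" and fC: "\<And>c. c \<in> C \<Longrightarrow> f c \<in> span B"
  shows "(\<Sum>b\<in>B. representation B (f (g b)) b) = (\<Sum>c\<in>C. representation C (g (f c)) c)"
proof -
  have rep: "representation B (f v) b = (\<Sum>c\<in>C. representation C v c * representation B (f c) b)"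
    if B: "independent B" and C: "independent C" "finite C" and f: "Vector_Spaces.linear scale scale f"
      and fC: "\<And>c. c \<in> C \<Longrightarrow> f c \<in> span B" and v: "v \<in> span C" for f v b B C
  proof -
    interpret f: Vector_Spaces.linear scale scale f by (rule f)
    have "f v = f (\<Sum>c\<in>C. scale (representation C v c) c)"
      by (simp add: sum_representation_eq C v)
    also have "\<dots> = (\<Sum>c\<in>C. scale (representation C v c) (f c))"
      by (simp add: f.sum f.scale)
    finally show ?thesis
      by (simp add: representation_sum[OF B] representation_scale[OF B] span_scale fC)
  qed
  have "(\<Sum>b\<in>B. representation B (f (g b)) b) =
      (\<Sum>b\<in>B. \<Sum>c\<in>C. representation C (g b) c * representation B (f c) b)"
    by (intro sum.cong refl rep[OF B(1) C f fC gB])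
  also have "\<dots> = (\<Sum>c\<in>C. \<Sum>b\<in>B. representation B (f c) b * representation C (g b) c)"
    by (subst sum.swap) (simp add: mult.commute)
  also have "\<dots> = (\<Sum>c\<in>C. representation C (g (f c)) c)"
    by (intro sum.cong refl rep[OF C(1) B g gB fC, symmetric])
  finally show ?thesis .
qed

text \<open>The basis picked by \<open>SOME\<close> depends on V alone, so traces of several maps
  can be compared in it.\<close>

lemma trace_on_basis:
  assumes V: "subspace V"
  obtains B where "B \<subseteq> V" "independent B" "span B = V"
    "\<And>f. trace_on scale V f = (\<Sum>b\<in>B. representation B (f b) b)"
proof -
  let ?P = "\<lambda>B. B \<subseteq> V \<and> independent B \<and> span B = V"
  obtain B where "B \<subseteq> V" "independent B" "V \<subseteq> span B"
    using maximal_independent_subset by blast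
  then have "?P B" using span_minimal[OF _ V] by auto
  then have "?P (SOME B. ?P B)" by (rule someI)
  then show thesis
    using that[of "SOME B. ?P B"] by (simp add: trace_on_def Let_def)
qed

lemma trace_on_add:
  assumes V: "subspace V" and "\<And>x. x \<in> V \<Longrightarrow> f x \<in> V" "\<And>x. x \<in> V \<Longrightarrow> g x \<in> V"
  shows "trace_on scale V (\<lambda>x. f x + g x) = trace_on scale V f + trace_on scale V g"
proof -
  obtain B where B: "B \<subseteq> V" "independent B" "span B = V"
    and tr: "\<And>f. trace_on scale V f = (\<Sum>b\<in>B. representation B (f b) b)"
    using trace_on_basis[OF V] by metis
  show ?thesis
    unfolding tr sum.distrib[symmetric]
    by (intro sum.cong refl) (use B assms in \<open>auto simp: representation_add subset_iff\<close>)
qed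

lemma trace_on_scale:
  assumes V: "subspace V" and "\<And>x. x \<in> V \<Longrightarrow> f x \<in> V"
  shows "trace_on scale V (\<lambda>x. scale c (f x)) = c * trace_on scale V f"
proof -
  obtain B where B: "B \<subseteq> V" "independent B" "span B = V"
    and tr: "\<And>f. trace_on scale V f = (\<Sum>b\<in>B. representation B (f b) b)"
    using trace_on_basis[OF V] by metis
  show ?thesis
    unfolding tr sum_distrib_left
    by (intro sum.cong refl) (use B assms in \<open>auto simp: representation_scale subset_iff\<close>)
qed

lemma trace_on_eq:
  assumes V: "subspace V" and fin: "\<And>B. B \<subseteq> V \<Longrightarrow> independent B \<Longrightarrow> finite B"
    and f: "Vector_Spaces.linear scale scale f" "\<And>x. x \<in> V \<Longrightarrow> f x \<in> V"
    and C: "C \<subseteq> V" "independent C" "span C = V"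
  shows "trace_on scale V f = (\<Sum>c\<in>C. representation C (f c) c)"
proof -
  obtain B where B: "B \<subseteq> V" "independent B" "span B = V"
    and tr: "\<And>f. trace_on scale V f = (\<Sum>b\<in>B. representation B (f b) b)"
    using trace_on_basis[OF V] by metis
  show ?thesis
    unfolding tr using trace_swap[OF B(2) fin[OF B(1,2)] C(2) fin[OF C(1,2)] f(1) linear_ident] B C f
    by (auto simp: subset_iff)
qed

lemma trace_on_comm:
  assumes V: "subspace V" and fin: "\<And>B. B \<subseteq> V \<Longrightarrow> independent B \<Longrightarrow> finite B"
    and f: "Vector_Spaces.linear scale scale f" "\<And>x. x \<in> V \<Longrightarrow> f x \<in> V"
    and g: "Vector_Spaces.linear scale scale g" "\<And>x. x \<in> V \<Longrightarrow> g x \<in> V"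
  shows "trace_on scale V (\<lambda>x. f (g x)) = trace_on scale V (\<lambda>x. g (f x))"
proof -
  obtain B where B: "B \<subseteq> V" "independent B" "span B = V"
    and tr: "\<And>f. trace_on scale V f = (\<Sum>b\<in>B. representation B (f b) b)"
    using trace_on_basis[OF V] by metis
  show ?thesis
    unfolding tr using trace_swap[OF B(2) fin[OF B(1,2)] B(2) fin[OF B(1,2)] f(1) g(1)] B f g
    by (auto simp: subset_iff)
qed

end

text \<open>Each coordinate in a basis of V is the restriction of a linear, hence bounded,
  functional on the whole space. The bound makes the trace insensitive to small changes of the
  operator.\<close>

lemma trace_on_bounded:
  fixes V :: "'a::euclidean_space set"
  assumes V: "subspace V"
  obtains C where "\<And>f. (\<And>x. x \<in> V \<Longrightarrow> blinfun_apply f x \<in> V) \<Longrightarrow> \<bar>trace_on scaleR V (blinfun_apply f)\<bar> \<le> C * norm f"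
proof -
  obtain B where B: "B \<subseteq> V" "independent B" "span B = V"
    and tr: "\<And>f. trace_on scaleR V f = (\<Sum>b\<in>B. representation B (f b) b)"
    using real_vector.trace_on_basis[OF V] by metis
  have "\<exists>C. \<forall>v\<in>V. \<bar>representation B v b\<bar> \<le> C * norm v" if b: "b \<in> B" for b
  proof -
    obtain \<phi> where \<phi>: "linear \<phi>" "\<And>c. c \<in> B \<Longrightarrow> \<phi> c = (if c = b then 1 else 0 :: real)"
      using linear_independent_extend[OF B(2), of "\<lambda>c. if c = b then 1 else 0 :: real"] by auto
    interpret \<phi>: linear \<phi> by (rule \<phi>(1))
    have rep: "representation B v b = \<phi> v" if "v \<in> V" for v
    proof -
      have v: "v \<in> span B" using that B by simp
      have fin: "finite B" using B(2) by (rule finiteI_independent)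
      have "\<phi> v = \<phi> (\<Sum>c\<in>B. representation B v c *\<^sub>R c)"
        by (simp add: real_vector.sum_representation_eq[OF B(2) v fin])
      also have "\<dots> = (\<Sum>c\<in>B. representation B v c * (if c = b then 1 else 0))"
        by (simp add: \<phi>.sum \<phi>.scale \<phi>(2) cong: sum.cong)
      also have "\<dots> = (\<Sum>c\<in>B. if c = b then representation B v c else 0)"
        by (intro sum.cong) auto
      also have "\<dots> = representation B v b"
        using fin b by simp
      finally show ?thesis by simp
    qed
    obtain K where "\<And>v. norm (\<phi> v) \<le> norm v * K"
      using \<phi>(1) bounded_linear.bounded linear_conv_bounded_linear by blast
    then show ?thesis
      using rep by (intro exI[of _ K]) (auto simp: mult.commute)
  qed
  then obtain C where C: "\<And>b v. b \<in> B \<Longrightarrow> v \<in> V \<Longrightarrow> \<bar>representation B v b\<bar> \<le> C b * norm v"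
    by metis
  show thesis
  proof (rule that)
    fix f :: "'a \<Rightarrow>\<^sub>L 'a" assume f: "\<And>x. x \<in> V \<Longrightarrow> f x \<in> V"
    have "\<bar>trace_on scaleR V (blinfun_apply f)\<bar> \<le> (\<Sum>b\<in>B. \<bar>representation B (f b) b\<bar>)"
      unfolding tr by (rule sum_abs)
    also have "\<dots> \<le> (\<Sum>b\<in>B. \<bar>C b\<bar> * norm b * norm f)"
    proof (rule sum_mono)
      fix b assume b: "b \<in> B"
      have "\<bar>representation B (f b) b\<bar> \<le> C b * norm (f b)"
        using C[OF b f] b B by auto
      also have "\<dots> \<le> \<bar>C b\<bar> * (norm f * norm b)"
        by (intro mult_mono norm_blinfun) auto
      finally show "\<bar>representation B (f b) b\<bar> \<le> \<bar>C b\<bar> * norm b * norm f"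
        by (simp add: mult_ac)
    qed
    finally show "\<bar>trace_on scaleR V (blinfun_apply f)\<bar> \<le> (\<Sum>b\<in>B. \<bar>C b\<bar> * norm b) * norm f"
      by (simp add: sum_distrib_right)
  qed
qed

section \<open>The real and complex Killing forms of a compact real form\<close>

locale compact_form = complex_lie_algebra sc br
  for sc :: "complex \<Rightarrow> 'g::euclidean_space \<Rightarrow> 'g" and br +
  fixes u :: "'g set"
  assumes crf: "compact_real_form sc br u"
begin

sublocale C: vector_space sc by (rule complex_vector_space)

lemma subspace_u: "subspace u"
  and br_u: "X \<in> u \<Longrightarrow> Y \<in> u \<Longrightarrow> br X Y \<in> u"
  and u_inter: "X \<in> u \<Longrightarrow> sc \<i> Y = X \<Longrightarrow> Y \<in> u \<Longrightarrow> X = 0"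
  using crf by (auto simp: compact_real_form_def real_form_def)

lemma decomp:
  obtains a b where "a \<in> u" "b \<in> u" "Z = sc \<i> a + b"
  using crf unfolding compact_real_form_def real_form_def by (metis add.commute imageE)

lemma sc_i_i [simp]: "sc \<i> (sc \<i> X) = - X"
  using sc_of_real[of "-1" X] by simp

lemma linear_sc: "linear (sc c)"
  by (rule linearI) (simp_all add: C.scale_right_distrib C.scale_left_commute mult.commute flip: sc_of_real)

lemma decomp_unique:
  assumes "a \<in> u" "b \<in> u" "a' \<in> u" "b' \<in> u" "sc \<i> a + b = sc \<i> a' + b'"
  shows "a = a'" "b = b'"
proof -
  have "b' - b = sc \<i> (a - a')"
    using assms(5) by (simp add: C.scale_right_diff_distrib algebra_simps)
  moreover have "b' - b \<in> u" "a - a' \<in> u"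
    using assms subspace_u by (auto intro: subspace_diff)
  ultimately have "b' - b = 0" using u_inter by metis
  then show "b = b'" by simp
  with \<open>b' - b = sc \<i> (a - a')\<close> show "a = a'" by simp
qed

lemma br_sc: "br (sc c X) Y = sc c (br X Y)" "br X (sc c Y) = sc c (br X Y)"
  using br_linear_left br_linear_right by (auto simp: Vector_Spaces.linear_iff)

lemmas br_add = linear_add[OF linear_br] linear_add[OF linear_br_left]
lemmas br_scaleR = linear_cmul[OF linear_br] linear_cmul[OF linear_br_left]

lemma linear_real: "linear f \<Longrightarrow> Vector_Spaces.linear scaleR scaleR f"
  by (simp add: Real_Vector_Spaces.linear_def)

lemma finite_indep: "independent B \<Longrightarrow> finite (B::'g set)"
  by (rule finiteI_independent)

abbreviation "tr \<equiv> trace_on scaleR u"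
abbreviation "\<beta> \<equiv> killing_form scaleR br u"

lemma tr_comm:
  assumes "linear f" "linear g" "\<And>x. x \<in> u \<Longrightarrow> f x \<in> u" "\<And>x. x \<in> u \<Longrightarrow> g x \<in> u"
  shows "tr (\<lambda>x. f (g x)) = tr (\<lambda>x. g (f x))"
  by (rule real_vector.trace_on_comm) (use assms subspace_u in \<open>auto intro: finite_indep linear_real\<close>)

lemma tr_add:
  assumes "\<And>x. x \<in> u \<Longrightarrow> f x \<in> u" "\<And>x. x \<in> u \<Longrightarrow> g x \<in> u"
  shows "tr (\<lambda>x. f x + g x) = tr f + tr g"
  by (rule real_vector.trace_on_add) (use assms subspace_u in auto)

lemma tr_scale:
  assumes "\<And>x. x \<in> u \<Longrightarrow> f x \<in> u"
  shows "tr (\<lambda>x. c *\<^sub>R f x) = c * tr f"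
  by (rule real_vector.trace_on_scale) (use assms subspace_u in auto)

lemma tr_diff:
  assumes "\<And>x. x \<in> u \<Longrightarrow> f x \<in> u" "\<And>x. x \<in> u \<Longrightarrow> g x \<in> u"
  shows "tr (\<lambda>x. f x - g x) = tr f - tr g"
  using tr_add[of f "\<lambda>x. (- 1) *\<^sub>R g x"] tr_scale[of g "- 1"] assms
  by (simp add: subspace_neg[OF subspace_u])

lemma \<beta>_sym: "X \<in> u \<Longrightarrow> Y \<in> u \<Longrightarrow> \<beta> X Y = \<beta> Y X"
  unfolding killing_form_def by (rule tr_comm) (auto intro: linear_br br_u)

lemma \<beta>_scale: "X \<in> u \<Longrightarrow> Y \<in> u \<Longrightarrow> \<beta> (c *\<^sub>R X) Y = c * \<beta> X Y"
  unfolding killing_form_def br_scaleR by (rule tr_scale) (auto intro: br_u)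

lemma \<beta>_neg_def: "X \<in> u \<Longrightarrow> \<beta> X X = 0 \<Longrightarrow> X = 0"
  using crf unfolding compact_real_form_def by force

lemma br_br: "br (br X Y) Z = br X (br Y Z) - br Y (br X Z)"
proof -
  have "br X (br Y Z) = - br Y (br Z X) - br Z (br X Y)"
    using jacobi[of X Y Z] by (simp add: algebra_simps eq_neg_iff_add_eq_0)
  also have "br Z (br X Y) = - br (br X Y) Z" by (rule br_skew)
  also have "br Z X = - br X Z" by (rule br_skew)
  finally show ?thesis by (simp add: linear_neg[OF linear_br])
qed

text \<open>With \<open>ad [X, Y]\<close> written as a commutator, cyclicity moves
  \<open>ad X\<close> to the end of the first trace, and the two traces combine to minus that of
  \<open>ad Y ad [X, Z]\<close>.\<close>

lemma \<beta>_invariant: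
  assumes u: "X \<in> u" "Y \<in> u" "Z \<in> u"
  shows "\<beta> (br X Y) Z = - \<beta> Y (br X Z)"
proof -
  note [intro] = br_u u
  have "\<beta> (br X Y) Z = tr (\<lambda>x. br X (br Y (br Z x))) - tr (\<lambda>x. br Y (br X (br Z x)))"
    unfolding killing_form_def br_br by (rule tr_diff) auto
  also have "tr (\<lambda>x. br X (br Y (br Z x))) = tr (\<lambda>x. br Y (br Z (br X x)))"
    by (rule tr_comm[OF linear_br linear_compose[OF linear_br linear_br, unfolded o_def]]) auto
  also have "tr (\<lambda>x. br Y (br Z (br X x))) - tr (\<lambda>x. br Y (br X (br Z x))) =
      - tr (\<lambda>x. br Y (br X (br Z x)) - br Y (br Z (br X x)))"
    by (subst tr_diff) auto
  also have "\<dots> = - \<beta> Y (br X Z)"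
    unfolding killing_form_def br_br by (simp add: linear_diff[OF linear_br])
  finally show ?thesis .
qed

lemma sc_Complex: "sc c X = Re c *\<^sub>R X + sc \<i> (Im c *\<^sub>R X)"
proof -
  have "sc c X = sc (complex_of_real (Re c) + \<i> * complex_of_real (Im c)) X"
    by (simp add: complex_eq[symmetric])
  also have "\<dots> = Re c *\<^sub>R X + sc \<i> (Im c *\<^sub>R X)"
    by (simp add: C.scale_left_distrib sc_of_real flip: C.scale_scale)
  finally show ?thesis .
qed

text \<open>Real and imaginary parts of the coefficients split a complex relation into one in u and
  one in i u, and these subspaces meet in 0. The lemma allows a real and a complex trace to be
  computed in one basis.\<close>

lemma complex_basis:
  assumes B: "B \<subseteq> u" "independent B" "span B = u"
  shows "C.independent B" "C.span B = UNIV"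
proof -
  have fin: "finite B" using B finite_indep by blast
  have sub: "x \<in> u" if "x = (\<Sum>b\<in>B. r b *\<^sub>R b)" for r x
    unfolding that by (intro subspace_sum[OF subspace_u] subspace_scale[OF subspace_u]) (use B in blast)
  have indep: "r b = 0" if "(\<Sum>b\<in>B. r b *\<^sub>R b) = 0" "b \<in> B" for r b
    using B(2) that fin independentD[OF B(2) fin order_refl] by blast
  show "C.independent B"
  proof (rule C.independent_if_scalars_zero[OF fin])
    fix f x assume f: "(\<Sum>x\<in>B. sc (f x) x) = 0" and x: "x \<in> B"
    define r where "r = (\<Sum>x\<in>B. Re (f x) *\<^sub>R x)"
    define i where "i = (\<Sum>x\<in>B. Im (f x) *\<^sub>R x)"
    have "sc \<i> i + r = 0"
      using f unfolding r_def i_def by (subst (asm) sc_Complex) (simp add: sum.distrib C.scale_sum_right add.commute)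
    then have "i = 0" "r = 0"
      using decomp_unique[of i r 0 0] sub[OF r_def] sub[OF i_def] subspace_0[OF subspace_u] by auto
    then show "f x = 0"
      using indep x unfolding r_def i_def by (auto simp: complex_eq_iff)
  qed
  show "C.span B = UNIV"
  proof -
    have u: "x \<in> C.span B" if "x \<in> u" for x
    proof -
      have "x \<in> span B" using that B by simp
      then have "x = (\<Sum>b\<in>B. representation B x b *\<^sub>R b)"
        using real_vector.sum_representation_eq[OF B(2) _ fin] by auto
      also have "\<dots> \<in> C.span B"
        unfolding sc_of_real[symmetric] by (intro C.span_sum C.span_scale C.span_base)
      finally show ?thesis .
    qed
    have "Z \<in> C.span B" for Z
    proof -
      obtain a b where "a \<in> u" "b \<in> u" "Z = sc \<i> a + b" by (rule decomp)
      then show ?thesis using u by (auto intro: C.span_add C.span_scale)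
    qed
    then show ?thesis by auto
  qed
qed

text \<open>In a real basis of u, which is also a complex basis of the algebra,
  \<open>ad X ad Y\<close> has the same real matrix over both fields.\<close>

lemma killing_complex:
  assumes X: "X \<in> u" and Y: "Y \<in> u"
  shows "killing_form sc br UNIV X Y = complex_of_real (\<beta> X Y)"
proof -
  obtain B where B: "B \<subseteq> u" "independent B" "span B = u"
    and tr: "\<And>f. tr f = (\<Sum>b\<in>B. representation B (f b) b)"
    using real_vector.trace_on_basis[OF subspace_u] by metis
  have fin: "finite B" using B finite_indep by blast
  note CB = complex_basis[OF B]
  have finC: "finite D" if "C.independent D" for D
  proof -
    have "D \<subseteq> C.span B" using CB by simp
    then show ?thesis using C.independent_span_bound[OF fin that] by blast
  qed
  have rep: "C.representation B v b = complex_of_real (representation B v b)" if v: "v \<in> u" for v b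
  proof -
    have vB: "v \<in> span B" using v B by simp
    have "C.representation B v = (\<lambda>b. complex_of_real (representation B v b))"
    proof (rule C.representation_eqI[OF CB(1)])
      show "v \<in> C.span B" by (simp add: CB)
      show nz: "b \<in> B" if "complex_of_real (representation B v b) \<noteq> 0" for b
        using that real_vector.representation_ne_zero by force
      then show "finite {b. complex_of_real (representation B v b) \<noteq> 0}"
        by (intro finite_subset[OF _ fin]) auto
      have "(\<Sum>b | complex_of_real (representation B v b) \<noteq> 0. sc (complex_of_real (representation B v b)) b)
          = (\<Sum>b | representation B v b \<noteq> 0. representation B v b *\<^sub>R b)"
        by (simp add: sc_of_real)
      also have "\<dots> = v"
        by (rule real_vector.sum_nonzero_representation_eq[OF B(2) vB])
      finally show "(\<Sum>b | complex_of_real (representation B v b) \<noteq> 0. sc (complex_of_real (representation B v b)) b) = v" .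
    qed
    then show ?thesis by simp
  qed
  have "killing_form sc br UNIV X Y = (\<Sum>b\<in>B. C.representation B (br X (br Y b)) b)"
    unfolding killing_form_def
    by (rule C.trace_on_eq) (use finC CB Vector_Spaces.linear_compose[OF br_linear_right br_linear_right, of X Y] in \<open>auto simp: o_def\<close>)
  also have "\<dots> = (\<Sum>b\<in>B. complex_of_real (representation B (br X (br Y b)) b))"
    by (intro sum.cong refl rep br_u X Y) (use B in blast)
  finally show ?thesis
    by (simp add: killing_form_def tr)
qed

lemma killing_add: "killing_form sc br UNIV (X + X') Y = killing_form sc br UNIV X Y + killing_form sc br UNIV X' Y"
    "killing_form sc br UNIV X (Y + Y') = killing_form sc br UNIV X Y + killing_form sc br UNIV X Y'"
  and killing_scale: "killing_form sc br UNIV (sc c X) Y = c * killing_form sc br UNIV X Y"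
    "killing_form sc br UNIV X (sc c Y) = c * killing_form sc br UNIV X Y"
  unfolding killing_form_def br_add br_sc
  by (rule C.trace_on_add C.trace_on_scale; simp)+

end

lemma bounded_bilinearI_euclidean:
  fixes b :: "'a::euclidean_space \<Rightarrow> 'b::euclidean_space \<Rightarrow> 'c::real_normed_vector"
  assumes "\<And>y. linear (\<lambda>x. b x y)" "\<And>x. linear (b x)"
  shows "bounded_bilinear b"
  using assms by (simp add: bilinear_conv_bounded_bilinear[symmetric] bilinear_def)

context compact_form begin

lemma bounded_bilinear_br: "bounded_bilinear br"
  by (rule bounded_bilinearI_euclidean[OF linear_br_left linear_br])

abbreviation "\<kappa> \<equiv> killing_form sc br UNIV"

lemma linear_killing: "linear (\<kappa> X)" "linear (\<lambda>X. \<kappa> X Y)"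
  by (rule linearI; simp add: killing_add killing_scale scaleR_conv_of_real flip: sc_of_real)+

text \<open>The largest value of the quadratic form on the compact unit sphere of u is negative, and
  homogeneity spreads the bound to all of u. The case u = {0} is separate because its sphere is
  empty.\<close>

lemma \<beta>_le_norm:
  obtains c where "c > 0" "\<And>s. s \<in> u \<Longrightarrow> \<beta> s s \<le> - c * (norm s)\<^sup>2"
proof (cases "u = {0}")
  case True
  have "\<beta> 0 0 = 0" using \<beta>_scale[of 0 0 0] True by simp
  then show ?thesis using that[of 1] True by simp
next
  case False
  define S where "S = {s \<in> u. norm s = 1}"
  have "S = sphere 0 1 \<inter> u" by (auto simp: S_def)
  then have "compact S"
    using closed_subspace[OF subspace_u] by (simp add: compact_Int_closed)
  have norml: "(1 / norm s) *\<^sub>R s \<in> S" if "s \<in> u" "s \<noteq> 0" for s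
    using that by (simp add: S_def subspace_scale[OF subspace_u])
  obtain s0 where "s0 \<in> u" "s0 \<noteq> 0" using False subspace_0[OF subspace_u] by auto
  then have "S \<noteq> {}" using norml by blast
  \<comment> \<open>\<beta> is a trace over u and has its meaning for arguments in u, whereas
    \<kappa> is bilinear on the whole space. Continuity is therefore read off from \<kappa> and
    restricted to the sphere.\<close>
  have b: "bounded_bilinear \<kappa>" by (rule bounded_bilinearI_euclidean[OF linear_killing(2,1)])
  have "continuous_on S (\<lambda>s. Re (\<kappa> s s))"
    by (intro continuous_intros bounded_bilinear.continuous_on[OF b])
  then have "continuous_on S (\<lambda>s. \<beta> s s)"
    by (rule continuous_on_eq) (simp add: killing_complex S_def)
  then obtain m where m: "m \<in> S" "\<And>s. s \<in> S \<Longrightarrow> \<beta> s s \<le> \<beta> m m"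
    using continuous_attains_sup[OF \<open>compact S\<close> \<open>S \<noteq> {}\<close>] by blast
  have "m \<noteq> 0" "m \<in> u" using m(1) by (auto simp: S_def)
  then have neg: "\<beta> m m < 0" using crf by (auto simp: compact_real_form_def)
  have "\<beta> s s \<le> - (- \<beta> m m) * (norm s)\<^sup>2" if s: "s \<in> u" for s
  proof (cases "s = 0")
    case True
    then show ?thesis using \<beta>_scale[of 0 0 0] subspace_0[OF subspace_u] by simp
  next
    case False
    define e where "e = (1 / norm s) *\<^sub>R s"
    have e: "e \<in> S" "e \<in> u" unfolding e_def using norml[OF s False] by (simp_all add: S_def)
    have "s = norm s *\<^sub>R e" using False by (simp add: e_def)
    then have "\<beta> s s = \<beta> (norm s *\<^sub>R e) (norm s *\<^sub>R e)" by simp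
    also have "\<dots> = norm s * \<beta> e (norm s *\<^sub>R e)"
      by (rule \<beta>_scale) (auto intro: e subspace_scale[OF subspace_u])
    also have "\<beta> e (norm s *\<^sub>R e) = \<beta> (norm s *\<^sub>R e) e"
      by (rule \<beta>_sym) (auto intro: e subspace_scale[OF subspace_u])
    also have "\<dots> = norm s * \<beta> e e" by (rule \<beta>_scale) (auto intro: e)
    finally have "\<beta> s s = \<beta> e e * (norm s)\<^sup>2" by (simp add: power2_eq_square)
    also have "\<dots> \<le> \<beta> m m * (norm s)\<^sup>2" using m(2)[OF e(1)] by (intro mult_right_mono) auto
    finally show ?thesis by simp
  qed
  then show ?thesis using that[of "- \<beta> m m"] neg by auto
qed

end

section \<open>The group action and the slice through \<open>h\<close>\<close>

locale compact_group_orbit = compact_form sc br u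
  for sc :: "complex \<Rightarrow> 'g::euclidean_space \<Rightarrow> 'g" and br u +
  fixes \<tau> :: "'g \<Rightarrow> 'g" and U :: "('g \<Rightarrow>\<^sub>L 'g) set" and h :: 'g
  assumes ci: "cartan_involution sc u \<tau>"
    and cg: "compact_group_of sc br u U"
    and h: "h \<in> u"
begin

lemma \<tau>: "linear \<tau>" "b \<in> u \<Longrightarrow> \<tau> b = b" "a \<in> u \<Longrightarrow> \<tau> (sc \<i> a) = - sc \<i> a"
  using ci by (auto simp: cartan_involution_def)

text \<open>The complex Killing form is real on u, so pairing i parts with i parts, or u parts with
  u parts, contributes real numbers; the imaginary part keeps the mixed terms.\<close>

lemma Omega_eq:
  assumes "a \<in> u" "b \<in> u" "a' \<in> u" "b' \<in> u"
  shows "Omega sc br \<tau> (sc \<i> a + b) (sc \<i> a' + b') = \<beta> b a' - \<beta> a b'"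
proof -
  have "\<tau> (sc \<i> a' + b') = sc \<i> (- a') + b'"
    using assms by (simp add: linear_add[OF \<tau>(1)] \<tau> linear_neg[OF linear_sc])
  then show ?thesis
    using assms by (simp add: Omega_def hermitian_form_def killing_add killing_scale
        linear_diff[OF linear_killing(1)] killing_complex)
qed

lemma Omega_skew: "Omega sc br \<tau> X Y = - Omega sc br \<tau> Y X"
proof -
  obtain a b where X: "a \<in> u" "b \<in> u" "X = sc \<i> a + b" by (rule decomp)
  obtain a' b' where Y: "a' \<in> u" "b' \<in> u" "Y = sc \<i> a' + b'" by (rule decomp)
  show ?thesis
    unfolding X(3) Y(3) Omega_eq[OF X(1,2) Y(1,2)] Omega_eq[OF Y(1,2) X(1,2)]
    using \<beta>_sym X Y by simp
qed

lemma bounded_bilinear_Omega: "bounded_bilinear (Omega sc br \<tau>)"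
proof (rule bounded_bilinearI_euclidean)
  show "linear (\<lambda>X. Omega sc br \<tau> X Y)" for Y
    unfolding Omega_def hermitian_form_def
    by (rule linearI) (simp_all add: linear_add[OF linear_killing(2)] linear_cmul[OF linear_killing(2)])
  show "linear (Omega sc br \<tau> X)" for X
    unfolding Omega_def hermitian_form_def
    by (rule linearI) (simp_all add: linear_add[OF linear_killing(1)] linear_cmul[OF linear_killing(1)]
        linear_add[OF \<tau>(1)] linear_cmul[OF \<tau>(1)])
qed

lemma U_Aut: "k \<in> U \<Longrightarrow> k \<in> carrier (Aut_group sc br)"
  using cg by (auto simp: compact_group_of_def dest: subgroup.mem_carrier)

lemma U_br: "k \<in> U \<Longrightarrow> k (br X Y) = br (k X) (k Y)"
  using U_Aut by (auto simp: Aut_group_def)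

lemma U_sc: "k \<in> U \<Longrightarrow> k (sc c X) = sc c (k X)"
  using U_Aut[of k] by (auto simp: Aut_group_def Vector_Spaces.linear_iff)

lemma linear_U: "linear (blinfun_apply k)"
  by (simp add: blinfun.bounded_linear_right bounded_linear.linear)

lemma U_u: "k \<in> U \<Longrightarrow> X \<in> u \<Longrightarrow> k X \<in> u"
  using compact_group_stabilizes[OF cg] by blast

lemma U_id: "id_blinfun \<in> U" and U_comp: "k \<in> U \<Longrightarrow> l \<in> U \<Longrightarrow> k o\<^sub>L l \<in> U"
  using cg subgroup.one_closed[of U "Aut_group sc br"] subgroup.m_closed[of U "Aut_group sc br" k l]
  by (auto simp: compact_group_of_def Aut_group_def)

lemma U_inverse:
  assumes k: "k \<in> U"
  obtains l where "l \<in> U" "k o\<^sub>L l = id_blinfun" "\<And>X. l (k X) = X" "\<And>X. k (l X) = X"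
proof -
  define l where "l = inv\<^bsub>Aut_group sc br\<^esub> k"
  have l: "l \<in> U"
    unfolding l_def using cg k by (auto simp: compact_group_of_def intro: subgroup.m_inv_closed)
  have "k o\<^sub>L l = id_blinfun" "l o\<^sub>L k = id_blinfun"
    using group.r_inv[OF group_Aut U_Aut[OF k]] group.l_inv[OF group_Aut U_Aut[OF k]]
    by (simp_all add: Aut_group_def l_def)
  then show thesis
    using that[OF l] by (metis blinfun_apply_blinfun_compose blinfun_apply_id_blinfun)
qed

lemma exp_ad_U: "X \<in> u \<Longrightarrow> exp_ad br (t *\<^sub>R X) \<in> U"
  using cg by (auto simp: compact_group_of_def lie_algebra_of_def)

text \<open>
  With \<open>T = ad h\<close> and \<open>E = ad s\<close> the relation \<open>k h = h + s\<close> reads \<open>E k = k T - T k\<close>. As \<open>E\<close> commutes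
  with \<open>T\<close>, the trace of \<open>E E k\<close> vanishes, while that of \<open>E E\<close> is the Killing form of \<open>s\<close>.
\<close>

lemma centralizer_rigid:
  obtains \<epsilon> where "\<epsilon> > 0"
    "\<And>k s. k \<in> U \<Longrightarrow> norm (k - id_blinfun) < \<epsilon> \<Longrightarrow> s \<in> u \<Longrightarrow> br h s = 0 \<Longrightarrow> k h = h + s \<Longrightarrow> s = 0"
proof -
  obtain c where c: "c > 0" "\<And>s. s \<in> u \<Longrightarrow> \<beta> s s \<le> - c * (norm s)\<^sup>2"
    by (rule \<beta>_le_norm) blast
  obtain C where C: "\<And>f. (\<And>x. x \<in> u \<Longrightarrow> blinfun_apply f x \<in> u) \<Longrightarrow> \<bar>tr (blinfun_apply f)\<bar> \<le> C * norm f"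
    by (rule trace_on_bounded[OF subspace_u]) blast
  obtain K where K: "K > 0" "\<And>x y. norm (br x y) \<le> norm x * norm y * K"
    using bounded_bilinear.pos_bounded[OF bounded_bilinear_br] by metis
  \<comment> \<open>The trace costs a factor C and the two brackets with s cost K^2 |s|^2. The
    summand 1 makes D positive, so that c / D is a legitimate radius.\<close>
  define D where "D = (\<bar>C\<bar> + 1) * K\<^sup>2"
  have D: "D > 0" using K by (simp add: D_def add_nonneg_pos)
  show thesis
  proof (rule that)
    show "c / D > 0" using c D by simp
  next
    fix k s assume k: "k \<in> U" and small: "norm (k - id_blinfun) < c / D" and s: "s \<in> u"
      and comm: "br h s = 0" and kh: "k h = h + s"
    note [intro] = br_u s h U_u[OF k]
    have ET: "br s (br h x) = br h (br s x)" for x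
      using br_br[of h s x] comm by (simp add: linear_0[OF linear_br_left])
    \<comment> \<open>k is an automorphism, so k [h, x] = [k h, k x] = [h, k x] + [s, k x].\<close>
    have Ek: "br s (k x) = k (br h x) - br h (k x)" for x
      by (simp add: U_br[OF k] kh br_add)
    have lin: "linear (\<lambda>x. br s (k x))"
      using linear_compose[OF linear_U linear_br] by (simp add: o_def)
    have "tr (\<lambda>x. br s (br s (k x))) = tr (\<lambda>x. br s (k (br h x)) - br h (br s (k x)))"
      by (simp add: Ek[symmetric] ET[symmetric] linear_diff[OF linear_br, symmetric])
    also have "\<dots> = tr (\<lambda>x. br s (k (br h x))) - tr (\<lambda>x. br h (br s (k x)))"
      by (rule tr_diff) auto
    also have "tr (\<lambda>x. br h (br s (k x))) = tr (\<lambda>x. br s (k (br h x)))"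
      by (rule tr_comm[OF linear_br lin]) auto
    finally have tr0: "tr (\<lambda>x. br s (br s (k x))) = 0" by simp
    define R where "R = k - id_blinfun"
    \<comment> \<open>This is E E (k - 1). Its trace equals - \<beta> s s, which is at least c
      |s|^2, while its norm is at most K^2 |k - 1| |s|^2.\<close>
    define f where "f = Blinfun (\<lambda>x. br s (br s (R x)))"
    have "linear (\<lambda>x. br s (br s (R x)))"
      using linear_compose[OF linear_compose[OF linear_U linear_br] linear_br] by (simp add: o_def)
    then have f: "blinfun_apply f = (\<lambda>x. br s (br s (R x)))"
      unfolding f_def by (intro bounded_linear_Blinfun_apply) (simp add: linear_conv_bounded_linear)
    have "tr (blinfun_apply f) = tr (\<lambda>x. br s (br s (k x)) - br s (br s x))"
      unfolding f R_def by (simp add: blinfun.diff_left linear_diff[OF linear_br])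
    also have "\<dots> = tr (\<lambda>x. br s (br s (k x))) - \<beta> s s"
      unfolding killing_form_def by (rule tr_diff) auto
    finally have trf: "tr (blinfun_apply f) = - \<beta> s s" by (simp add: tr0)
    have "norm f \<le> K\<^sup>2 * norm R * (norm s)\<^sup>2"
    proof (rule norm_blinfun_bound)
      fix x
      have "norm (f x) \<le> norm s * norm (br s (R x)) * K"
        unfolding f by (rule K(2))
      also have "\<dots> \<le> norm s * (norm s * norm (R x) * K) * K"
        using K by (intro mult_right_mono mult_left_mono) auto
      also have "\<dots> \<le> norm s * (norm s * (norm R * norm x) * K) * K"
        using K by (intro mult_right_mono mult_left_mono norm_blinfun) auto
      finally show "norm (f x) \<le> K\<^sup>2 * norm R * (norm s)\<^sup>2 * norm x"
        by (simp add: power2_eq_square mult_ac)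
    qed simp
    have "c * (norm s)\<^sup>2 \<le> \<bar>tr (blinfun_apply f)\<bar>"
      using c(2)[OF s] unfolding trf by simp
    also have "\<dots> \<le> C * norm f"
      by (rule C) (auto simp: f R_def blinfun.diff_left intro!: br_u subspace_diff[OF subspace_u] U_u[OF k] s)
    also have "\<dots> \<le> (\<bar>C\<bar> + 1) * norm f"
      by (intro mult_right_mono) auto
    also have "\<dots> \<le> (\<bar>C\<bar> + 1) * (K\<^sup>2 * norm R * (norm s)\<^sup>2)"
      by (intro mult_left_mono \<open>norm f \<le> _\<close>) auto
    also have "\<dots> = (D * norm R) * (norm s)\<^sup>2" by (simp add: D_def mult_ac)
    finally have "(c - D * norm R) * (norm s)\<^sup>2 \<le> 0" by (simp add: left_diff_distrib)
    moreover have "c - D * norm R > 0"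
      using small D by (simp add: R_def pos_less_divide_eq mult.commute)
    ultimately have "(norm s)\<^sup>2 \<le> 0" by (simp add: mult_le_0_iff)
    then show "s = 0" by simp
  qed
qed

text \<open>If k n h tends to h, a subsequence of k n converges in \<open>U\<close> to some q fixing
  h. Composing on the right with the inverse of q leaves the values at h unchanged and makes the
  elements tend to the identity.\<close>

lemma orbit_near_id:
  assumes \<epsilon>: "\<epsilon> > 0"
  shows "\<exists>\<delta>>0. \<forall>k\<in>U. norm (k h - h) < \<delta> \<longrightarrow> (\<exists>l\<in>U. norm (l - id_blinfun) < \<epsilon> \<and> l h = k h)"
proof (rule ccontr)
  assume "\<not> ?thesis"
  then have "\<exists>k. k \<in> U \<and> norm (k h - h) < \<delta> \<and> \<not> (\<exists>l\<in>U. norm (l - id_blinfun) < \<epsilon> \<and> l h = k h)"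
    if "\<delta> > 0" for \<delta> :: real
    using that by blast
  then have "\<forall>n. \<exists>k. k \<in> U \<and> norm (k h - h) < inverse (real (Suc n)) \<and>
      \<not> (\<exists>l\<in>U. norm (l - id_blinfun) < \<epsilon> \<and> l h = k h)"
    by simp
  then obtain k where k: "\<And>n. k n \<in> U" "\<And>n. norm (k n h - h) < inverse (real (Suc n))"
    "\<And>n l. l \<in> U \<Longrightarrow> norm (l - id_blinfun) < \<epsilon> \<Longrightarrow> l h \<noteq> k n h"
    by metis
  have "compact U" using cg by (simp add: compact_group_of_def)
  then obtain q r where q: "q \<in> U" and r: "strict_mono r" "(k \<circ> r) \<longlonglongrightarrow> q"
    using k(1) unfolding compact_def by metis
  have "(\<lambda>n. k (r n) h) \<longlonglongrightarrow> q h"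
    using r(2) unfolding o_def by (intro blinfun.tendsto tendsto_const)
  moreover have "(\<lambda>n. k (r n) h) \<longlonglongrightarrow> h"
  proof -
    have "(\<lambda>n. k n h - h) \<longlonglongrightarrow> 0"
      by (rule Lim_null_comparison[OF _ LIMSEQ_inverse_real_of_nat]) (use k(2) in \<open>auto simp: less_imp_le\<close>)
    then have "(\<lambda>n. k n h) \<longlonglongrightarrow> h" by (rule LIM_zero_cancel)
    then show ?thesis using LIMSEQ_subseq_LIMSEQ[OF _ r(1)] by (simp add: o_def)
  qed
  ultimately have qh: "q h = h" by (rule LIMSEQ_unique)
  obtain p where p: "p \<in> U" "q o\<^sub>L p = id_blinfun" "\<And>X. p (q X) = X"
    using U_inverse[OF q] by metis
  have "(\<lambda>n. k (r n) o\<^sub>L p) \<longlonglongrightarrow> (q o\<^sub>L p)"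
    using r(2) unfolding o_def by (intro bounded_bilinear.tendsto[OF bounded_bilinear_blinfun_compose] tendsto_const)
  then have "(\<lambda>n. norm ((k (r n) o\<^sub>L p) - id_blinfun)) \<longlonglongrightarrow> 0"
    unfolding p(2) tendsto_dist_iff[where l = id_blinfun] dist_norm .
  then have "\<forall>\<^sub>F n in sequentially. norm ((k (r n) o\<^sub>L p) - id_blinfun) < \<epsilon>"
    using \<epsilon> by (rule order_tendstoD)
  then obtain n where n: "norm ((k (r n) o\<^sub>L p) - id_blinfun) < \<epsilon>"
    using eventually_happens'[OF sequentially_bot] by blast
  have "p h = h" using p(3)[of h] qh by simp
  then show False
    using k(3)[OF U_comp[OF k(1) p(1)] n, of "r n"] by simp
qed

text \<open>Closeness of k h to h is all that is known when the slice is compared with the orbit.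
  Exchanging k for an element near the identity with the same value at h makes
  \<open>centralizer_rigid\<close> applicable.\<close>

lemma orbit_slice:
  obtains \<delta> where "\<delta> > 0"
    "\<And>k s. k \<in> U \<Longrightarrow> s \<in> u \<Longrightarrow> br h s = 0 \<Longrightarrow> k h = h + s \<Longrightarrow> norm s < \<delta> \<Longrightarrow> s = 0"
proof -
  obtain \<epsilon> where \<epsilon>: "\<epsilon> > 0"
    "\<And>k s. k \<in> U \<Longrightarrow> norm (k - id_blinfun) < \<epsilon> \<Longrightarrow> s \<in> u \<Longrightarrow> br h s = 0 \<Longrightarrow> k h = h + s \<Longrightarrow> s = 0"
    by (rule centralizer_rigid) blast
  obtain \<delta> where \<delta>: "\<delta> > 0"
    "\<And>k. k \<in> U \<Longrightarrow> norm (k h - h) < \<delta> \<Longrightarrow> \<exists>l\<in>U. norm (l - id_blinfun) < \<epsilon> \<and> l h = k h"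
    using orbit_near_id[OF \<epsilon>(1)] by blast
  show thesis
  proof (rule that[OF \<delta>(1)])
    fix k s assume "k \<in> U" and s: "s \<in> u" "br h s = 0" "k h = h + s" "norm s < \<delta>"
    then obtain l where "l \<in> U" "norm (l - id_blinfun) < \<epsilon>" "l h = k h"
      using \<delta>(2)[of k] by auto
    then show "s = 0" using \<epsilon>(2) s by metis
  qed
qed

end

section \<open>Adjoint exponentials\<close>

context complex_lie_algebra begin

lemma exp_ad_0 [simp]: "exp_ad br 0 X = X"
proof -
  have "br 0 = (\<lambda>Y. 0)" by (simp add: fun_eq_iff linear_0[OF linear_br_left])
  then have "(br 0 ^^ n) X /\<^sub>R fact n = 0" if "n \<noteq> 0" for n
    using that by (cases n) auto
  then have "exp_ad br 0 X = (\<Sum>n\<in>{0}. (br 0 ^^ n) X /\<^sub>R fact n)"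
    unfolding exp_ad_apply by (intro suminf_finite) auto
  then show ?thesis by simp
qed

text \<open>Each coordinate is a real power series in t, and the coefficients of its formal
  derivative are those belonging to \<open>br X v\<close>. With the bracket inside the exponential,
  the derivative stays in the same family, so smoothness follows by induction with v
  arbitrary.\<close>

lemma exp_ad_has_vector_derivative:
  "((\<lambda>t. exp_ad br (t *\<^sub>R X) v) has_vector_derivative exp_ad br (t *\<^sub>R X) (br X v)) (at t)"
  unfolding has_vector_derivative_def
proof (subst has_derivative_componentwise_within, intro ballI)
  fix b :: 'g assume "b \<in> Basis"
  define c where "c v n = ((br X ^^ n) v \<bullet> b) / fact n" for v n
  have pw: "(br (t *\<^sub>R X) ^^ n) v = t ^ n *\<^sub>R (br X ^^ n) v" for t v n
    by (induction n) (simp_all add: linear_cmul[OF linear_br] linear_cmul[OF linear_br_left])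
  have coeff: "((br (t *\<^sub>R X) ^^ n) v /\<^sub>R fact n) \<bullet> b = c v n * t ^ n" for t v n
    by (simp add: pw c_def divide_inverse)
  have sm: "summable (\<lambda>n. c v n * t ^ n)" for t v
    using bounded_linear.summable[OF bounded_linear_inner_left summable_exp_ad[of "t *\<^sub>R X" v], of b]
    unfolding coeff .
  have sum: "exp_ad br (t *\<^sub>R X) v \<bullet> b = (\<Sum>n. c v n * t ^ n)" for t v
    unfolding exp_ad_apply bounded_linear.suminf[OF bounded_linear_inner_left summable_exp_ad] coeff ..
  have "diffs (c v) = c (br X v)"
  proof
    fix n
    show "diffs (c v) n = c (br X v) n"
      by (simp add: diffs_def c_def funpow_swap1 del: of_nat_Suc)
  qed
  then have "((\<lambda>t. \<Sum>n. c v n * t ^ n) has_field_derivative (\<Sum>n. c (br X v) n * t ^ n)) (at t)"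
    using termdiffs_strong_converges_everywhere[of "c v" t] sm by simp
  moreover have "(\<lambda>x. x *\<^sub>R exp_ad br (t *\<^sub>R X) (br X v) \<bullet> b) = (*) (\<Sum>n. c (br X v) n * t ^ n)"
    by (rule ext) (simp add: sum mult.commute)
  ultimately show "((\<lambda>t. exp_ad br (t *\<^sub>R X) v \<bullet> b) has_derivative (\<lambda>x. x *\<^sub>R exp_ad br (t *\<^sub>R X) (br X v) \<bullet> b)) (at t)"
    unfolding has_field_derivative_def sum by (simp only:)
qed

lemma Ck_exp_ad: "Ck_on n (\<lambda>t. exp_ad br (t *\<^sub>R X) v) (UNIV :: real set)"
proof (induction n arbitrary: v)
  case 0
  then show ?case
    using has_vector_derivative_continuous[OF exp_ad_has_vector_derivative]
    by (simp add: continuous_on_eq_continuous_within)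
next
  case (Suc n)
  show ?case
    by (rule Ck_on_SucI[OF open_UNIV exp_ad_has_vector_derivative[unfolded has_vector_derivative_def]])
      (intro Ck_on_bilinear[OF open_UNIV bounded_bilinear_scaleR] Ck_on_const Suc)
qed

text \<open>Separates the dependence on the exponent from that on the vector, so that the product
  rule handles expressions in which both vary.\<close>

lemma exp_ad_basis_sum: "exp_ad br X w = (\<Sum>b\<in>Basis. (w \<bullet> b) *\<^sub>R exp_ad br X b)"
proof -
  have "exp_ad br X w = exp_ad br X (\<Sum>b\<in>Basis. (w \<bullet> b) *\<^sub>R b)" by (simp add: euclidean_representation)
  then show ?thesis by (simp only: blinfun.sum_right blinfun.scaleR_right)
qed

lemma Ck_exp_ad_apply:
  fixes w :: "'b::euclidean_space \<Rightarrow> 'g"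
  assumes w: "Ck_on n w UNIV"
  shows "Ck_on n (\<lambda>x. exp_ad br ((x \<bullet> e) *\<^sub>R X) (w x)) UNIV"
proof -
  have "Ck_on n (\<lambda>x. exp_ad br ((x \<bullet> e) *\<^sub>R X) b) UNIV" for b
    by (rule Ck_on_compose[OF open_UNIV open_UNIV _ Ck_exp_ad])
      (auto intro: Ck_on_linear[OF open_UNIV bounded_linear_inner_left Ck_on_ident[OF open_UNIV]])
  then show ?thesis
    by (subst exp_ad_basis_sum) (intro Ck_on_sum[OF open_UNIV] Ck_on_bilinear[OF open_UNIV bounded_bilinear_scaleR]
      Ck_on_linear[OF open_UNIV bounded_linear_inner_left] w)
qed

lemma exp_ad_apply_has_derivative:
  fixes w :: "'b::euclidean_space \<Rightarrow> 'g"
  assumes w: "(w has_derivative w') (at 0)"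
  shows "((\<lambda>x. exp_ad br ((x \<bullet> e) *\<^sub>R X) (w x)) has_derivative (\<lambda>v. (v \<bullet> e) *\<^sub>R br X (w 0) + w' v)) (at 0)"
proof -
  have l: "((\<lambda>x. x \<bullet> e) has_derivative (\<lambda>v. v \<bullet> e)) (at 0)"
    by (auto intro!: derivative_eq_intros)
  have 1: "((\<lambda>x. exp_ad br ((x \<bullet> e) *\<^sub>R X) b) has_derivative (\<lambda>v. (v \<bullet> e) *\<^sub>R br X b)) (at 0)" for b
    using has_derivative_compose[OF l exp_ad_has_vector_derivative[unfolded has_vector_derivative_def], of X b]
    by simp
  have "((\<lambda>x. \<Sum>b\<in>Basis. (w x \<bullet> b) *\<^sub>R exp_ad br ((x \<bullet> e) *\<^sub>R X) b) has_derivative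
      (\<lambda>v. \<Sum>b\<in>Basis. (w 0 \<bullet> b) *\<^sub>R ((v \<bullet> e) *\<^sub>R br X b) + (w' v \<bullet> b) *\<^sub>R exp_ad br ((0 \<bullet> e) *\<^sub>R X) b)) (at 0)"
    by (intro has_derivative_sum has_derivative_scaleR has_derivative_inner_left w 1)
  moreover have "(\<Sum>b\<in>Basis. (w 0 \<bullet> b) *\<^sub>R ((v \<bullet> e) *\<^sub>R br X b) + (w' v \<bullet> b) *\<^sub>R exp_ad br ((0 \<bullet> e) *\<^sub>R X) b)
      = (v \<bullet> e) *\<^sub>R br X (w 0) + w' v" for v
  proof -
    have "br X (w 0) = br X (\<Sum>b\<in>Basis. (w 0 \<bullet> b) *\<^sub>R b)" by (simp add: euclidean_representation)
    also have "\<dots> = (\<Sum>b\<in>Basis. (w 0 \<bullet> b) *\<^sub>R br X b)"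
      by (simp only: linear_sum[OF linear_br] linear_cmul[OF linear_br])
    finally show ?thesis
      by (simp add: sum.distrib scaleR_sum_right euclidean_representation mult.commute)
  qed
  ultimately show ?thesis
    by (subst exp_ad_basis_sum) simp
qed

text \<open>Coordinates of the second kind. Each factor has one real parameter, so derivatives of
  one-parameter groups suffice and \<open>exp_ad br X\<close> is never differentiated in a general
  direction of X.\<close>

definition exp_prod :: "('b::euclidean_space \<Rightarrow> 'g) \<Rightarrow> 'b list \<Rightarrow> 'b \<Rightarrow> 'g \<Rightarrow> 'g"
  where "exp_prod X es x w = foldr (\<lambda>e. blinfun_apply (exp_ad br ((x \<bullet> e) *\<^sub>R X e))) es w"

lemma exp_prod_simps [simp]:
  "exp_prod X [] x w = w"
  "exp_prod X (e # es) x w = exp_ad br ((x \<bullet> e) *\<^sub>R X e) (exp_prod X es x w)"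
  by (simp_all add: exp_prod_def)

lemma Ck_exp_prod:
  assumes "Ck_on n w UNIV" shows "Ck_on n (\<lambda>x. exp_prod X es x (w x)) UNIV"
  using assms by (induction es) (auto intro: Ck_exp_ad_apply)

lemma exp_prod_0 [simp]: "exp_prod X es 0 w = w"
  by (induction es) auto

text \<open>All factors are the identity at 0, so at first order the contributions add up
  irrespective of their order.\<close>

lemma exp_prod_has_derivative:
  assumes "(w has_derivative w') (at 0)"
  shows "((\<lambda>x. exp_prod X es x (w x)) has_derivative (\<lambda>v. (\<Sum>e\<leftarrow>es. (v \<bullet> e) *\<^sub>R br (X e) (w 0)) + w' v)) (at 0)"
proof (induction es)
  case (Cons e es)
  from exp_ad_apply_has_derivative[OF Cons, of e "X e"] show ?case
    by (simp add: add.assoc)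
qed (use assms in simp)

end

lemma linear_projection:
  fixes V W :: "'a::real_vector set"
  assumes V: "subspace V" and W: "subspace W" and VW: "V \<inter> W \<subseteq> {0}"
    and sum: "\<And>x. \<exists>v\<in>V. x - v \<in> W"
  obtains \<pi> where "linear \<pi>" "\<And>x. \<pi> x \<in> V" "\<And>x. x - \<pi> x \<in> W" "\<And>x v. v \<in> V \<Longrightarrow> x - v \<in> W \<Longrightarrow> \<pi> x = v"
proof -
  obtain \<pi> where \<pi>: "\<And>x. \<pi> x \<in> V" "\<And>x. x - \<pi> x \<in> W" using sum by metis
  have uniq: "\<pi> x = v" if "v \<in> V" "x - v \<in> W" for x v
  proof -
    have "\<pi> x - v \<in> V" using \<pi>(1) that(1) by (rule subspace_diff[OF V])
    moreover have "(x - v) - (x - \<pi> x) \<in> W" using that(2) \<pi>(2) by (rule subspace_diff[OF W])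
    ultimately show ?thesis using VW by auto
  qed
  have "linear \<pi>"
  proof (rule linearI)
    fix x y :: 'a and r :: real
    have "(x - \<pi> x) + (y - \<pi> y) \<in> W" using \<pi>(2) by (intro subspace_add[OF W])
    then show "\<pi> (x + y) = \<pi> x + \<pi> y"
      by (intro uniq subspace_add[OF V] \<pi>(1)) (simp add: algebra_simps)
    have "r *\<^sub>R (x - \<pi> x) \<in> W" using \<pi>(2) by (intro subspace_scale[OF W])
    then show "\<pi> (r *\<^sub>R x) = r *\<^sub>R \<pi> x"
      by (intro uniq subspace_scale[OF V] \<pi>(1)) (simp add: algebra_simps)
  qed
  then show thesis using that \<pi> uniq by blast
qed

section \<open>The semi-direct product orbit\<close>

context compact_group_orbit begin

text \<open>\<open>m\<close> plays the part of the tangent space at h of the adjoint orbit of h, and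
  \<open>z\<close> is the centralizer of h in u. They are orthogonal complements for the Killing
  form.\<close>

definition "m = br h ` u"
definition "z = {X \<in> u. br h X = 0}"
definition "M = Uad_orbit br \<tau> U (sc \<i> ` u) (sc \<i> h)"
definition P where "P v = (1/2) *\<^sub>R (v - \<tau> v)"

lemma subspace_m: "subspace m" and subspace_z: "subspace z" and m_u: "m \<subseteq> u" and z_u: "z \<subseteq> u"
  using subspace_u linear_subspace_image[OF linear_br]
  by (auto simp: m_def z_def h br_u subspace_def br_add br_scaleR linear_0[OF linear_br])

text \<open>For X = [h, Y], invariance gives \<beta> X X = - \<beta> Y [h, X], which vanishes when X
  centralizes h; definiteness then forces X = 0.\<close>

lemma m_inter_z: "X \<in> m \<Longrightarrow> X \<in> z \<Longrightarrow> X = 0"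
proof -
  assume "X \<in> m" "X \<in> z"
  then obtain Y where Y: "Y \<in> u" "X = br h Y" and X: "X \<in> u" "br h X = 0"
    by (auto simp: m_def z_def)
  have "\<beta> X X = - \<beta> Y (br h X)"
    unfolding Y(2) using \<beta>_invariant[OF h Y(1) X(1)] unfolding Y(2) .
  also have "\<dots> = 0"
    using \<beta>_scale[of 0 Y 0] \<beta>_sym[of Y 0] Y(1) subspace_0[OF subspace_u] by (simp add: X(2))
  finally show ?thesis using \<beta>_neg_def X(1) by blast
qed

text \<open>\<open>ad h\<close> is injective on \<open>m\<close>, hence maps \<open>m\<close> onto itself.\<close>

lemma u_decomp:
  assumes X: "X \<in> u"
  obtains a where "a \<in> m" "X - a \<in> z"
proof -
  have sub: "br h ` m \<subseteq> m"
    using m_u by (auto simp: m_def)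
  have "inj_on (br h) m"
  proof (rule inj_onI)
    fix X Y assume XY: "X \<in> m" "Y \<in> m" "br h X = br h Y"
    then have "X - Y \<in> m" by (intro subspace_diff[OF subspace_m])
    moreover from this have "X - Y \<in> z"
      using XY m_u by (auto simp: z_def linear_diff[OF linear_br])
    ultimately show "X = Y" using m_inter_z by force
  qed
  then have "dim (br h ` m) = dim m"
    using subspace_m by (intro dim_image_eq linear_br) (simp add: span_eq_iff[THEN iffD2])
  then have "br h ` m = m"
    using sub subspace_m by (intro subspace_dim_equal linear_subspace_image[OF linear_br]) auto
  moreover have "br h X \<in> m" using X by (simp add: m_def)
  ultimately obtain a where a: "a \<in> m" "br h X = br h a" by auto
  then have "X - a \<in> z"
    using X m_u by (auto simp: z_def linear_diff[OF linear_br] intro: subspace_diff[OF subspace_u])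
  with a show thesis using that by blast
qed

lemma linear_P: "linear P"
  unfolding P_def[abs_def]
  by (rule linearI) (simp_all add: linear_add[OF \<tau>(1)] linear_cmul[OF \<tau>(1)] algebra_simps)

lemma P_eq: "a \<in> u \<Longrightarrow> b \<in> u \<Longrightarrow> P (sc \<i> a + b) = sc \<i> a"
  by (simp add: P_def linear_add[OF \<tau>(1)] \<tau> flip: scaleR_2)

lemma P_u: "b \<in> u \<Longrightarrow> P b = 0"
  by (simp add: P_def \<tau>)

lemma br_sc_sc: "br (sc \<i> X) (sc \<i> Y) = - br X Y"
  by (simp add: br_sc)

text \<open>Pulling k out of the translation part gives [k (i h), i C] = - k [h, l C], with l the
  inverse of k, so all fibres are images of the single space \<open>m\<close>.\<close>

lemma M_eq: "M = {blinfun_apply k (sc \<i> h + b) |k b. k \<in> U \<and> b \<in> m}"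
proof -
  have rf: "real_form sc br u" using crf by (simp add: compact_real_form_def)
  have M: "M = (\<Union>Y\<in>(\<lambda>k. blinfun_apply k (sc \<i> h)) ` U. (\<lambda>X. Y + br Y X) ` (sc \<i> ` u))"
    unfolding M_def using h by (intro Uad_orbit_eq[OF rf ci cg]) auto
  show ?thesis
  proof (intro equalityI subsetI)
    fix p assume "p \<in> M"
    then obtain k C where k: "k \<in> U" and C: "C \<in> u"
      and p: "p = blinfun_apply k (sc \<i> h) + br (k (sc \<i> h)) (sc \<i> C)" unfolding M by auto
    obtain l where l: "l \<in> U" "\<And>X. k (l X) = X" using U_inverse[OF k] by metis
    have "br (k (sc \<i> h)) (sc \<i> C) = k (- br h (l C))"
      by (simp add: U_sc[OF k] br_sc_sc U_br[OF k] l blinfun.minus_right)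
    then have "p = k (sc \<i> h + - br h (l C))" by (simp only: p blinfun.add_right)
    moreover have "- br h (l C) \<in> m"
      using U_u[OF l(1) C] by (intro subspace_neg[OF subspace_m]) (auto simp: m_def)
    ultimately show "p \<in> {blinfun_apply k (sc \<i> h + b) |k b. k \<in> U \<and> b \<in> m}" using k by blast
  next
    fix p assume "p \<in> {blinfun_apply k (sc \<i> h + b) |k b. k \<in> U \<and> b \<in> m}"
    then obtain k C where k: "k \<in> U" and C: "C \<in> u" and p: "p = blinfun_apply k (sc \<i> h + br h C)"
      unfolding m_def by auto
    have "k (br h C) = br (k (sc \<i> h)) (sc \<i> (- k C))"
      unfolding U_sc[OF k] br_sc_sc by (simp add: U_br[OF k] linear_neg[OF linear_br])
    then have "p = k (sc \<i> h) + br (k (sc \<i> h)) (sc \<i> (- k C))"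
      by (simp only: p blinfun.add_right)
    moreover have "- k C \<in> u" using U_u[OF k C] by (rule subspace_neg[OF subspace_u])
    ultimately show "p \<in> M" unfolding M using k by blast
  qed
qed

lemma M_I: "k \<in> U \<Longrightarrow> b \<in> m \<Longrightarrow> blinfun_apply k (sc \<i> h + b) \<in> M"
  unfolding M_eq by blast

text \<open>
  The maps \<open>v \<mapsto> k (v + [C, P v])\<close> with \<open>C \<in> i u\<close> form a group of linear automorphisms, because
  \<open>P [C, P v] = 0\<close>.
\<close>

lemma M_homogeneous:
  assumes p: "p \<in> M"
  obtains k C A B where "k \<in> U" "C \<in> u" "\<And>v. A v = blinfun_apply k (v + br (sc \<i> C) (P v))"
    "linear A" "linear B" "\<And>x. A (B x) = x" "\<And>x. B (A x) = x" "A ` M \<subseteq> M" "B ` M \<subseteq> M" "A (sc \<i> h) = p"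
proof -
  obtain k C where k: "k \<in> U" and C: "C \<in> u" and p: "p = blinfun_apply k (sc \<i> h + br h C)"
    using p unfolding M_eq m_def by auto
  obtain l where l: "l \<in> U" "\<And>X. l (k X) = X" "\<And>X. k (l X) = X" using U_inverse[OF k] by metis
  define N where "N v = br (sc \<i> C) (P v)" for v
  have linN: "linear N"
    unfolding N_def[abs_def] using linear_compose[OF linear_P linear_br] by (simp add: o_def)
  have N_u: "N v \<in> u" for v
  proof -
    obtain a b where ab: "a \<in> u" "b \<in> u" "v = sc \<i> a + b" by (rule decomp)
    have "N v = - br C a" unfolding N_def ab(3) P_eq[OF ab(1,2)] br_sc_sc ..
    then show ?thesis using br_u[OF C ab(1)] subspace_neg[OF subspace_u] by simp
  qed
  have NN: "N (N v) = 0" for v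
    using P_u[OF N_u[of v]] by (simp add: N_def linear_0[OF linear_br])
  define A where "A v = k (v + N v)" for v
  define B where "B v = l v - N (l v)" for v
  have linA: "linear A"
    by (rule linearI) (simp_all add: A_def linear_add[OF linN] linear_cmul[OF linN] blinfun.add_right blinfun.scaleR_right scaleR_add_right)
  have linB: "linear B"
    by (rule linearI) (simp_all add: B_def linear_add[OF linN] linear_cmul[OF linN] blinfun.add_right blinfun.scaleR_right scaleR_diff_right)
  have AB: "A (B x) = x" and BA: "B (A x) = x" for x
    by (simp_all add: A_def B_def l linear_add[OF linN] linear_diff[OF linN] NN)
  \<comment> \<open>N moves a point within its fibre: N sees just the i part of the point, and
    [q h, C] = q [h, q' C] lies in q m.\<close>
  have N_M: "\<exists>c\<in>m. N (blinfun_apply q (sc \<i> h + b)) = blinfun_apply q c" if q: "q \<in> U" and b: "b \<in> m" for q b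
  proof -
    obtain q' where q': "q' \<in> U" "\<And>X. q (q' X) = X" using U_inverse[OF q] by metis
    have "q (sc \<i> h + b) = sc \<i> (q h) + q b" by (simp add: blinfun.add_right U_sc[OF q])
    then have "N (q (sc \<i> h + b)) = br (sc \<i> C) (sc \<i> (q h))"
      using U_u[OF q] h b m_u by (simp add: N_def P_eq subset_iff)
    also have "\<dots> = br (q h) C" using br_skew[of C "q h"] by (simp add: br_sc_sc)
    also have "\<dots> = q (br h (q' C))" by (simp add: U_br[OF q] q')
    finally show ?thesis using U_u[OF q'(1) C] by (auto simp: m_def)
  qed
  have AM: "A ` M \<subseteq> M"
  proof clarify
    fix x assume "x \<in> M"
    then obtain q b where q: "q \<in> U" "b \<in> m" and x: "x = blinfun_apply q (sc \<i> h + b)" by (auto simp: M_eq)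
    obtain c where c: "c \<in> m" "N (q (sc \<i> h + b)) = q c" using N_M[OF q] by blast
    have "A x = (k o\<^sub>L q) (sc \<i> h + (b + c))"
      unfolding A_def x c(2) by (simp add: blinfun.add_right add.assoc)
    then show "A x \<in> M"
      using M_I[OF U_comp[OF k q(1)] subspace_add[OF subspace_m q(2) c(1)]] by simp
  qed
  have BM: "B ` M \<subseteq> M"
  proof clarify
    fix x assume "x \<in> M"
    then obtain q b where q: "q \<in> U" "b \<in> m" and x: "x = blinfun_apply q (sc \<i> h + b)" by (auto simp: M_eq)
    obtain c where c: "c \<in> m" "N ((l o\<^sub>L q) (sc \<i> h + b)) = (l o\<^sub>L q) c"
      using N_M[OF U_comp[OF l(1) q(1)] q(2)] by blast
    have "B x = (l o\<^sub>L q) (sc \<i> h + b) - (l o\<^sub>L q) c"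
      unfolding B_def x using c(2) by simp
    then have "B x = (l o\<^sub>L q) (sc \<i> h + (b - c))"
      by (simp add: blinfun.add_right blinfun.diff_right)
    then show "B x \<in> M"
      using M_I[OF U_comp[OF l(1) q(1)] subspace_diff[OF subspace_m q(2) c(1)]] by simp
  qed
  have "N (sc \<i> h) = br h C"
    using P_eq[OF h subspace_0[OF subspace_u]] br_skew[of C h] by (simp add: N_def br_sc_sc)
  then have "A (sc \<i> h) = p" by (simp add: A_def p)
  then show thesis
    using that[OF k C _ linA linB AB BA AM BM] by (simp add: A_def N_def)
qed

text \<open>The projection along i z + u. Its image provides the coordinates that move along the
  orbit of h, its kernel the slice and fibre coordinates.\<close>

lemma projection_onto_i_m:
  obtains \<pi> where "linear \<pi>" "\<And>x. \<pi> x \<in> sc \<i> ` m" "\<And>x. \<exists>s\<in>z. \<exists>b\<in>u. x - \<pi> x = sc \<i> s + b"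
    "\<And>a b. a \<in> m \<Longrightarrow> b \<in> u \<Longrightarrow> \<pi> (sc \<i> a + b) = sc \<i> a"
proof -
  define W where "W = (\<lambda>(s, b). sc \<i> s + b) ` (z \<times> u)"
  have lin: "linear (\<lambda>(s, b). sc \<i> s + b)"
    by (rule linearI) (auto simp: linear_add[OF linear_sc] linear_cmul[OF linear_sc] scaleR_add_right)
  have W: "subspace W"
    unfolding W_def by (intro linear_subspace_image[OF lin] subspace_Times subspace_z subspace_u)
  have V: "subspace (sc \<i> ` m)" by (intro linear_subspace_image[OF linear_sc] subspace_m)
  have VW: "sc \<i> ` m \<inter> W \<subseteq> {0}"
  proof clarify
    fix a assume a: "a \<in> m" "sc \<i> a \<in> W"
    then obtain s b where s: "s \<in> z" "b \<in> u" "sc \<i> a + 0 = sc \<i> s + b" by (auto simp: W_def)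
    then have "a = s"
      using decomp_unique(1)[OF _ _ _ _ s(3)] a(1) m_u z_u subspace_0[OF subspace_u] by auto
    then show "sc \<i> a = 0" using m_inter_z a(1) s(1) by simp
  qed
  have sum: "\<exists>v\<in>sc \<i> ` m. x - v \<in> W" for x
  proof -
    obtain a b where ab: "a \<in> u" "b \<in> u" "x = sc \<i> a + b" by (rule decomp)
    obtain a' where a': "a' \<in> m" "a - a' \<in> z" using u_decomp[OF ab(1)] .
    have "x - sc \<i> a' = sc \<i> (a - a') + b"
      by (simp add: ab(3) linear_diff[OF linear_sc])
    then have "x - sc \<i> a' \<in> W"
      using a'(2) ab(2) by (auto simp: W_def image_iff)
    then show ?thesis using a'(1) by blast
  qed
  obtain \<pi> where \<pi>: "linear \<pi>" "\<And>x. \<pi> x \<in> sc \<i> ` m" "\<And>x. x - \<pi> x \<in> W"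
    "\<And>x v. v \<in> sc \<i> ` m \<Longrightarrow> x - v \<in> W \<Longrightarrow> \<pi> x = v"
    using linear_projection[OF V W VW sum] by metis
  show thesis
  proof (rule that[OF \<pi>(1,2)])
    show "\<exists>s\<in>z. \<exists>b\<in>u. x - \<pi> x = sc \<i> s + b" for x
      using \<pi>(3)[of x] by (auto simp: W_def)
    show "\<pi> (sc \<i> a + b) = sc \<i> a" if "a \<in> m" "b \<in> u" for a b
    proof (rule \<pi>(4))
      show "sc \<i> a + b - sc \<i> a \<in> W"
        unfolding W_def by (rule image_eqI[of _ _ "(0, b)"]) (use that(2) subspace_0[OF subspace_z] in auto)
    qed (use that in blast)
  qed
qed

end

section \<open>Charts, tangent spaces and nondegeneracy\<close>

context compact_group_orbit begin

text \<open>The parameter space: the part \<open>sc \<i> a\<close> drives the product of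
  exponentials, and \<open>b\<close> is the fibre coordinate.\<close>

definition "L = (\<lambda>(a, b). sc \<i> a + b) ` (m \<times> m)"

lemma linear_pair: "linear (\<lambda>(a, b). sc \<i> a + b)"
  by (rule linearI) (auto simp: linear_add[OF linear_sc] linear_cmul[OF linear_sc] scaleR_add_right)

lemma subspace_L: "subspace L"
  unfolding L_def by (intro linear_subspace_image[OF linear_pair] subspace_Times subspace_m)

lemma L_I: "a \<in> m \<Longrightarrow> b \<in> m \<Longrightarrow> sc \<i> a + b \<in> L"
  unfolding L_def by (rule image_eqI[of _ _ "(a, b)"]) auto

lemma L_E:
  assumes "x \<in> L" obtains a b where "a \<in> m" "b \<in> m" "x = sc \<i> a + b"
  using assms unfolding L_def by auto

lemma exp_prod_U:
  assumes "\<And>e. X e \<in> u"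
  shows "\<exists>k\<in>U. \<forall>w. exp_prod X es x w = blinfun_apply k w"
proof (induction es)
  case Nil
  then show ?case using U_id by (intro bexI[of _ id_blinfun]) auto
next
  case (Cons e es)
  then obtain k where k: "k \<in> U" "\<And>w. exp_prod X es x w = blinfun_apply k w" by blast
  show ?case
    by (rule bexI[OF _ U_comp[OF exp_ad_U[OF assms[of e], of "x \<bullet> e"] k(1)]]) (simp add: k(2))
qed

text \<open>
  The chart at \<open>i h\<close>: the product of exponentials moves along \<open>Ad(U) h\<close>, and the second argument is a
  slice transversal to the orbit in the directions complementary to \<open>L\<close>.
\<close>

lemma chart_at_base_point:
  obtains N V f g where "open N" "open V" "0 \<in> N" "homeomorphism N V f g"
    "\<And>n. Ck_on n f UNIV" "\<And>n. Ck_on n g V" "M \<inter> V = f ` (L \<inter> N)" "f ` L \<subseteq> M" "f 0 = sc \<i> h"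
    "\<And>a b. a \<in> m \<Longrightarrow> b \<in> m \<Longrightarrow> frechet_derivative f (at 0) (sc \<i> a + b) = sc \<i> (br a h) + b"
proof -
  obtain \<pi> where lin\<pi>: "linear \<pi>" and \<pi>_m: "\<And>x. \<pi> x \<in> sc \<i> ` m"
    and \<pi>_compl: "\<And>x. \<exists>s\<in>z. \<exists>b\<in>u. x - \<pi> x = sc \<i> s + b"
    and \<pi>_eq: "\<And>a b. a \<in> m \<Longrightarrow> b \<in> u \<Longrightarrow> \<pi> (sc \<i> a + b) = sc \<i> a"
    using projection_onto_i_m by metis
  have bl\<pi>: "bounded_linear \<pi>" using lin\<pi> by (simp add: linear_conv_bounded_linear)
  \<comment> \<open>X x is the coordinate a of x in i a + (i s + b); the sign undoes i i = -1. Being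
    linear, X makes the first-order motion of the exponential product equal to
    \<open>ad (X v)\<close>.\<close>
  define X where "X x = - sc \<i> (\<pi> x)" for x
  have linX: "linear X"
    by (rule linearI) (simp_all add: X_def linear_add[OF lin\<pi>] linear_cmul[OF lin\<pi>] linear_add[OF linear_sc] linear_cmul[OF linear_sc])
  have X_eq: "X (sc \<i> a + b) = a" if "a \<in> m" "b \<in> u" for a b
    by (simp add: X_def \<pi>_eq that)
  have X_u: "X x \<in> u" for x
    using \<pi>_m[of x] m_u by (auto simp: X_def)
  have dec: "\<exists>a\<in>m. \<exists>s\<in>z. \<exists>b\<in>u. x = sc \<i> a + (sc \<i> s + b) \<and> \<pi> x = sc \<i> a \<and> X x = a" for x
  proof -
    obtain a where a: "a \<in> m" "\<pi> x = sc \<i> a" using \<pi>_m[of x] by auto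
    moreover obtain s b where sb: "s \<in> z" "b \<in> u" "x - \<pi> x = sc \<i> s + b" using \<pi>_compl[of x] by auto
    ultimately show ?thesis by (intro bexI[of _ a] bexI[of _ s] bexI[of _ b]) (auto simp: X_def algebra_simps)
  qed
  obtain es :: "'g list" where es: "set es = Basis" "distinct es"
    using finite_distinct_list[OF finite_Basis] by blast
  define w where "w x = sc \<i> h + (x - \<pi> x)" for x
  define f where "f x = exp_prod X es x (w x)" for x
  have w0: "w 0 = sc \<i> h" by (simp add: w_def linear_0[OF lin\<pi>])
  have f0: "f 0 = sc \<i> h" by (simp add: f_def w0)
  have Ckw: "Ck_on n w UNIV" for n
  proof -
    have "bounded_linear (\<lambda>x. x - \<pi> x)" by (intro bounded_linear_sub bounded_linear_ident bl\<pi>)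
    then show ?thesis
      unfolding w_def[abs_def]
      by (intro Ck_on_add[OF open_UNIV] Ck_on_const Ck_on_linear[OF open_UNIV _ Ck_on_ident[OF open_UNIV]])
  qed
  have Ckf: "Ck_on n f UNIV" for n
    unfolding f_def[abs_def] by (rule Ck_exp_prod[OF Ckw])
  have dw: "(w has_derivative (\<lambda>v. v - \<pi> v)) (at 0)"
    unfolding w_def[abs_def]
    by (auto intro!: derivative_eq_intros bounded_linear.has_derivative[OF bl\<pi>])
  define D where "D v = br (X v) (sc \<i> h) + (v - \<pi> v)" for v
  have sumX: "(\<Sum>e\<leftarrow>es. (v \<bullet> e) *\<^sub>R br (X e) (sc \<i> h)) = br (X v) (sc \<i> h)" for v
  proof -
    have "(\<Sum>e\<leftarrow>es. (v \<bullet> e) *\<^sub>R br (X e) (sc \<i> h)) = (\<Sum>e\<in>Basis. (v \<bullet> e) *\<^sub>R br (X e) (sc \<i> h))"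
      using sum_list_distinct_conv_sum_set[OF es(2)] es(1) by metis
    also have "\<dots> = br (X (\<Sum>e\<in>Basis. (v \<bullet> e) *\<^sub>R e)) (sc \<i> h)"
      by (simp only: linear_sum[OF linX] linear_cmul[OF linX] linear_sum[OF linear_br_left] br_scaleR)
    finally show ?thesis by (simp add: euclidean_representation)
  qed
  have df: "(f has_derivative D) (at 0)"
    using exp_prod_has_derivative[OF dw, of X es] unfolding f_def[abs_def] D_def[abs_def] w0 sumX .
  have D_eq: "D (sc \<i> a + (sc \<i> s + b)) = sc \<i> (br a h + s) + b"
    if "sc \<i> a + (sc \<i> s + b) = v" "\<pi> v = sc \<i> a" "X v = a" for a s b v
  proof -
    have "D v = sc \<i> (br a h) + (v - sc \<i> a)" by (simp add: D_def that(2,3) br_sc)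
    then show ?thesis using that(1) by (auto simp: linear_add[OF linear_sc])
  qed
  have br_m: "br a h \<in> m" if "a \<in> u" for a
    using br_skew[of a h] subspace_neg[OF subspace_m, of "br h a"] that by (simp add: m_def)
  \<comment> \<open>D sends i a + i s + b to i ([a, h] + s) + b. As [a, h] is in m and s in z, both
    vanish together, and then a lies in m and in z.\<close>
  have injD: "inj D"
  proof -
    have linD: "linear D" using df by (rule has_derivative_linear)
    have "v = 0" if "D v = 0" for v
    proof -
      obtain a s b where v: "a \<in> m" "s \<in> z" "b \<in> u" "v = sc \<i> a + (sc \<i> s + b)" "\<pi> v = sc \<i> a" "X v = a"
        using dec[of v] by blast
      have "sc \<i> (br a h + s) + b = sc \<i> 0 + 0"
        using D_eq[OF v(4)[symmetric] v(5,6)] that v(4) by simp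
      moreover have u: "a \<in> u" "s \<in> u" using v m_u z_u by auto
      ultimately have b: "b = 0" and as: "br a h + s = 0"
        using decomp_unique[of "br a h + s" b 0 0] v(3) h subspace_0[OF subspace_u]
          subspace_add[OF subspace_u] br_u by auto
      have "s = - br a h" using as by (simp add: eq_neg_iff_add_eq_0 add.commute)
      then have "s \<in> m" using br_m[OF u(1)] subspace_neg[OF subspace_m] by simp
      then have s: "s = 0" using v(2) m_inter_z by blast
      then have "br h a = 0" using as br_skew[of h a] by simp
      then have "a = 0" using v(1) u(1) m_inter_z by (auto simp: z_def)
      then show ?thesis using v(4) b s by simp
    qed
    then show ?thesis using linear_injective_0[OF linD] by blast
  qed
  have fU: "\<exists>k\<in>U. f x = blinfun_apply k (w x)" for x
    using exp_prod_U[of X es x, OF X_u] unfolding f_def by blast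
  obtain \<delta> where \<delta>: "\<delta> > 0"
    "\<And>k s. k \<in> U \<Longrightarrow> s \<in> u \<Longrightarrow> br h s = 0 \<Longrightarrow> k h = h + s \<Longrightarrow> norm s < \<delta> \<Longrightarrow> s = 0"
    by (rule orbit_slice) blast
  \<comment> \<open>For x - \<pi> x = i s + b the vector inside the norm is - s. The outer
    multiplication by i is there because the auxiliary norm need not be invariant under it.\<close>
  define S where "S = {x. norm (sc \<i> (P (x - \<pi> x))) < \<delta>}"
  have "linear (\<lambda>x. sc \<i> (P (x - \<pi> x)))"
    using linear_compose[OF linear_compose[OF linear_compose_sub[OF linear_ident lin\<pi>] linear_P] linear_sc]
    by (simp add: o_def)
  then have "continuous_on UNIV (\<lambda>x. sc \<i> (P (x - \<pi> x)))"
    by (simp add: linear_continuous_on linear_conv_bounded_linear)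
  then have S: "open S"
    unfolding S_def by (intro open_Collect_less continuous_intros)
  have S0: "0 \<in> S"
    using \<delta>(1) by (simp add: S_def linear_0[OF lin\<pi>] linear_0[OF linear_P])
  obtain N V g where N: "open N" "N \<subseteq> S" "0 \<in> N" and V: "open V" and hom: "homeomorphism N V f g"
    and Ckg: "\<And>n. Ck_on n g V"
    using smooth_inverse_function[OF S Ck_on_subset[OF Ckf] S0 df injD] by (metis subset_UNIV)
  have fL: "f ` L \<subseteq> M"
  proof clarify
    fix x assume "x \<in> L"
    then obtain a b where ab: "a \<in> m" "b \<in> m" "x = sc \<i> a + b" by (rule L_E)
    have "w x = sc \<i> h + b"
      using \<pi>_eq[OF ab(1), of b] ab m_u by (auto simp: w_def)
    then show "f x \<in> M" using fU[of x] M_I ab(2) by auto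
  qed
  have "M \<inter> V = f ` (L \<inter> N)"
  proof
    show "f ` (L \<inter> N) \<subseteq> M \<inter> V" using fL hom by (auto simp: homeomorphism_def)
    show "M \<inter> V \<subseteq> f ` (L \<inter> N)"
    proof
      fix p assume p: "p \<in> M \<inter> V"
      define x where "x = g p"
      have x: "x \<in> N" "f x = p" using hom p by (auto simp: homeomorphism_def x_def)
      obtain k where k: "k \<in> U" "f x = k (w x)" using fU by blast
      obtain l where l: "l \<in> U" "\<And>X. l (k X) = X" using U_inverse[OF k(1)] by metis
      obtain q b' where q: "q \<in> U" "b' \<in> m" "p = blinfun_apply q (sc \<i> h + b')"
        using p by (auto simp: M_eq)
      \<comment> \<open>Now w x = r (i h + b'). Comparing i parts gives r h = h + s, so s = 0 by the
        slice property. Then r fixes h, hence maps m into itself, and b = r b' lies in m.\<close>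
      define r where "r = l o\<^sub>L q"
      have r: "r \<in> U" unfolding r_def by (rule U_comp[OF l(1) q(1)])
      have "w x = r (sc \<i> h + b')"
        using l(2)[of "w x"] k(2) x(2) q(3) by (simp add: r_def)
      then have wx: "w x = sc \<i> (r h) + r b'" by (simp add: blinfun.add_right U_sc[OF r])
      obtain a s b where v: "a \<in> m" "s \<in> z" "b \<in> u" "x = sc \<i> a + (sc \<i> s + b)" "\<pi> x = sc \<i> a"
        using dec[of x] by blast
      have xs: "x - \<pi> x = sc \<i> s + b" using v(4,5) by simp
      then have "sc \<i> (h + s) + b = sc \<i> (r h) + r b'"
        using wx by (simp add: w_def linear_add[OF linear_sc] add.assoc)
      moreover have su: "s \<in> u" "br h s = 0" using v(2) by (auto simp: z_def)
      moreover have "r h \<in> u" "r b' \<in> u" using U_u[OF r] h q(2) m_u by auto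
      ultimately have rh: "r h = h + s" and rb: "r b' = b"
        using decomp_unique[of "h + s" b "r h" "r b'"] v(3) h subspace_add[OF subspace_u] by auto
      have "norm s < \<delta>"
        using x(1) N(2) by (auto simp: S_def xs P_eq[OF su(1) v(3)])
      then have "s = 0" using \<delta>(2)[OF r su rh] by blast
      then have "r h = h" using rh by simp
      obtain C where C: "C \<in> u" "b' = br h C" using q(2) by (auto simp: m_def)
      have "b = br h (r C)" using rb C(2) \<open>r h = h\<close> by (simp add: U_br[OF r])
      then have "b \<in> m" using U_u[OF r C(1)] by (auto simp: m_def)
      then have "x \<in> L" using v(1,4) \<open>s = 0\<close> L_I by simp
      then show "p \<in> f ` (L \<inter> N)" using x by blast
    qed
  qed
  moreover have "frechet_derivative f (at 0) (sc \<i> a + b) = sc \<i> (br a h) + b" if ab: "a \<in> m" "b \<in> m" for a b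
  proof -
    have "b \<in> u" using ab m_u by auto
    then show ?thesis
      using D_eq[of a 0 b "sc \<i> a + b"] \<pi>_eq[OF ab(1)] X_eq[OF ab(1)] frechet_derivative_at[OF df] by simp
  qed
  ultimately show thesis
    using that[OF N(1) V N(3) hom Ckf Ckg _ fL f0] by blast
qed

lemma submanifold_M: "submanifold (dim L) M"
  unfolding submanifold_def
proof
  fix p assume "p \<in> M"
  then obtain A B :: "'g \<Rightarrow> 'g" where A: "linear A" "linear B" "\<And>x. A (B x) = x" "\<And>x. B (A x) = x"
    "A ` M \<subseteq> M" "B ` M \<subseteq> M" "A (sc \<i> h) = p"
    by (rule M_homogeneous) blast
  obtain N V f g where c: "open N" "open V" "0 \<in> N" "homeomorphism N V f g"
    "\<And>n. Ck_on n f UNIV" "\<And>n. Ck_on n g V" "M \<inter> V = f ` (L \<inter> N)" "f 0 = sc \<i> h"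
    by (rule chart_at_base_point) blast
  have "local_param M L (L \<inter> N) (\<lambda>x. A (f x))"
    by (rule local_param_linear_image[OF c(1,2,4) Ck_on_subset[OF c(5)] c(6) subspace_L c(7) A(1-6)]) simp
  moreover have "p \<in> (\<lambda>x. A (f x)) ` (L \<inter> N)"
    by (rule image_eqI[of _ _ 0]) (use c(3,8) A(7) subspace_0[OF subspace_L] in auto)
  ultimately show "\<exists>L' Q \<psi>. local_param M L' Q \<psi> \<and> dim L' = dim L \<and> p \<in> \<psi> ` Q"
    by blast
qed

text \<open>The chart bounds the tangent space from above. Every vector in the bound is attained by
  a curve f (t x) with x in L, which stays in M for all t since f maps the whole of L into
  M.\<close>

lemma tangent_space_base: "tangent_space M (sc \<i> h) = {sc \<i> (br a h) + b |a b. a \<in> m \<and> b \<in> m}"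
proof -
  obtain N V f g where c: "open N" "open V" "0 \<in> N" "homeomorphism N V f g"
    "\<And>n. Ck_on n f UNIV" "\<And>n. Ck_on n g V" "M \<inter> V = f ` (L \<inter> N)" "f ` L \<subseteq> M" "f 0 = sc \<i> h"
    and D: "\<And>a b. a \<in> m \<Longrightarrow> b \<in> m \<Longrightarrow> frechet_derivative f (at 0) (sc \<i> a + b) = sc \<i> (br a h) + b"
    by (rule chart_at_base_point) blast
  have df: "(f has_derivative frechet_derivative f (at 0)) (at 0)"
    using Ck_on_SucD(1)[OF c(5)[of "Suc 0"]] by simp
  show ?thesis
  proof (intro equalityI subsetI)
    fix v assume "v \<in> tangent_space M (sc \<i> h)"
    then have "v \<in> frechet_derivative f (at 0) ` L"
      using tangent_space_chart[OF c(2,4) c(6)[of 1] c(1) subspace_L c(7,3) df] c(9) by simp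
    then show "v \<in> {sc \<i> (br a h) + b |a b. a \<in> m \<and> b \<in> m}"
      using D by (auto elim!: L_E)
  next
    fix v assume "v \<in> {sc \<i> (br a h) + b |a b. a \<in> m \<and> b \<in> m}"
    then obtain a b where ab: "a \<in> m" "b \<in> m" and v: "v = sc \<i> (br a h) + b" by blast
    define x where "x = sc \<i> a + b"
    have x: "x \<in> L" unfolding x_def by (rule L_I[OF ab])
    have Ckl: "Ck_on n (\<lambda>t::real. t *\<^sub>R x) UNIV" for n
      by (rule Ck_on_linear[OF open_UNIV bounded_linear_scaleR_left Ck_on_ident[OF open_UNIV]])
    have "Ck_on n (\<lambda>t::real. f (t *\<^sub>R x)) UNIV" for n
      by (rule Ck_on_compose[OF open_UNIV open_UNIV _ c(5) Ckl]) simp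
    then have "smooth_on {-1<..<1::real} (\<lambda>t. f (t *\<^sub>R x))"
      unfolding smooth_on_def by blast
    moreover have "(\<lambda>t. f (t *\<^sub>R x)) ` {-1<..<1} \<subseteq> M"
      using c(8) subspace_scale[OF subspace_L x] by blast
    moreover have "((\<lambda>t. f (t *\<^sub>R x)) has_vector_derivative v) (at 0)"
    proof -
      have "((\<lambda>t::real. t *\<^sub>R x) has_derivative (\<lambda>t. t *\<^sub>R x)) (at 0)"
        by (auto intro!: derivative_eq_intros)
      then have "((\<lambda>t. f (t *\<^sub>R x)) has_derivative (\<lambda>t. frechet_derivative f (at 0) (t *\<^sub>R x))) (at 0)"
        by (rule has_derivative_compose) (simp add: df)
      then show ?thesis
        unfolding has_vector_derivative_def linear_cmul[OF has_derivative_linear[OF df]] x_def D[OF ab] v .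
    qed
    ultimately show "v \<in> tangent_space M (sc \<i> h)"
      unfolding tangent_space_def using c(9) by (auto intro!: exI[of _ "\<lambda>t. f (t *\<^sub>R x)"] exI[of _ "1::real"])
  qed
qed

lemma nondegenerate_M: "nondegenerate_on M (\<lambda>p. Omega sc br \<tau>)"
  unfolding nondegenerate_on_def
proof (intro ballI impI)
  fix p v assume p: "p \<in> M" and v: "v \<in> tangent_space M p"
    and orth: "\<forall>w\<in>tangent_space M p. Omega sc br \<tau> v w = 0"
  obtain k C A B where k: "k \<in> U" and C: "C \<in> u" and A_eq: "\<And>v. A v = blinfun_apply k (v + br (sc \<i> C) (P v))"
    and A: "linear A" "linear B" "\<And>x. A (B x) = x" "\<And>x. B (A x) = x"
    "A ` M \<subseteq> M" "B ` M \<subseteq> M" "A (sc \<i> h) = p"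
    using M_homogeneous[OF p] by metis
  have "B v \<in> tangent_space M (sc \<i> h)"
    using tangent_space_linear_image[OF A(2,6) v] A(4)[of "sc \<i> h"] A(7) by simp
  then obtain a b where ab: "a \<in> m" "b \<in> m" and Bv: "B v = sc \<i> (br a h) + b"
    unfolding tangent_space_base by blast
  have br_m: "br a h \<in> m" if "a \<in> m" for a
    using br_skew[of a h] subspace_neg[OF subspace_m, of "br h a"] that m_u by (auto simp: m_def)
  have T: "A (sc \<i> (br a' h) + b') \<in> tangent_space M p" if "a' \<in> m" "b' \<in> m" for a' b'
    using tangent_space_linear_image[OF A(1,5), of "sc \<i> (br a' h) + b'" "sc \<i> h"] A(7) that
    unfolding tangent_space_base by auto
  have A_sc: "A (sc \<i> a + b) = sc \<i> (k a) + (k b - k (br C a))" if "a \<in> u" "b \<in> u" for a b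
    unfolding A_eq P_eq[OF that] br_sc_sc
    by (simp add: blinfun.add_right blinfun.diff_right U_sc[OF k] blinfun.minus_right)
  have u: "k x \<in> u" "k x - k (br C y) \<in> u" if "x \<in> u" "y \<in> u" for x y
    using that U_u[OF k] br_u[OF C] subspace_diff[OF subspace_u] by auto
  have m0: "0 \<in> m" "0 \<in> u" using subspace_0[OF subspace_m] subspace_0[OF subspace_u] by auto
  have k0: "x = 0" if "k x = 0" for x
    using U_inverse[OF k] that by (metis blinfun.zero_right)
  have \<beta>0: "\<beta> x 0 = 0" "\<beta> 0 x = 0" if "x \<in> u" for x
    using \<beta>_scale[of 0 x 0] \<beta>_sym[OF that m0(2)] that m0(2) by auto
  define \<alpha> where "\<alpha> = br a h"
  have \<alpha>: "\<alpha> \<in> m" "\<alpha> \<in> u" and b: "b \<in> u" using br_m[OF ab(1)] ab m_u by (auto simp: \<alpha>_def)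
  have v_eq: "v = sc \<i> (k \<alpha>) + (k b - k (br C \<alpha>))"
    using A(3)[of v] A_sc[OF \<alpha>(2) b] unfolding Bv \<alpha>_def by simp
  \<comment> \<open>First test vector: the fibre vector k \<alpha> has no i part, so the form
    reduces to - \<beta> (k \<alpha>) (k \<alpha>).\<close>
  have "A (sc \<i> (br 0 h) + \<alpha>) = sc \<i> 0 + k \<alpha>"
    using A_sc[OF m0(2) \<alpha>(2)] by (simp add: linear_0[OF linear_br] linear_0[OF linear_br_left])
  then have "Omega sc br \<tau> v (sc \<i> 0 + k \<alpha>) = 0"
    using orth T[OF m0(1) \<alpha>(1)] by metis
  then have "\<beta> (k \<alpha>) (k \<alpha>) = 0"
    unfolding v_eq using Omega_eq[of "k \<alpha>" "k b - k (br C \<alpha>)" 0 "k \<alpha>"] u \<alpha>(2) b m0(2) \<beta>0 by simp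
  then have "\<alpha> = 0" using k0 \<beta>_neg_def[OF u(1)[OF \<alpha>(2) \<alpha>(2)]] by blast
  then have v_eq: "v = sc \<i> 0 + k b"
    using v_eq by (simp add: linear_0[OF linear_br])
  \<comment> \<open>The second test vector is A (i b). For it to be tangent, b must be a bracket
    [a, h] with a in m, and D is therefore replaced by its component in m.\<close>
  obtain D where D: "D \<in> u" "b = br h D" using ab(2) by (auto simp: m_def)
  obtain a' where a': "a' \<in> m" "D - a' \<in> z" using u_decomp[OF D(1)] .
  have "br h D = br h a'" using a'(2) by (simp add: z_def linear_diff[OF linear_br])
  then have "b = br (- a') h"
    using D(2) br_skew[of h a'] by (simp add: linear_neg[OF linear_br_left])
  moreover have "- a' \<in> m" using a'(1) by (rule subspace_neg[OF subspace_m])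
  ultimately have "A (sc \<i> b + 0) \<in> tangent_space M p" using T[OF _ m0(1)] by blast
  then have "Omega sc br \<tau> v (sc \<i> (k b) + (k 0 - k (br C b))) = 0"
    using orth A_sc[OF b m0(2)] by metis
  then have "\<beta> (k b) (k b) = 0"
    unfolding v_eq using Omega_eq[OF m0(2) u(1)[OF b b] u(1)[OF b b] u(2)[OF m0(2) b]] \<beta>0 u(1)[OF b b] u(2)[OF m0(2) b]
    by simp
  then have "b = 0" using k0 \<beta>_neg_def[OF u(1)[OF b b]] by blast
  then show "v = 0" using v_eq by simp
qed

lemma symplectic_M: "symplectic_form_on M (\<lambda>p. Omega sc br \<tau>)"
  unfolding symplectic_form_on_def
  using submanifold_M two_form_on_constant[OF bounded_bilinear_Omega Omega_skew]
    closed_form_on_constant[OF bounded_bilinear_Omega Omega_skew] nondegenerate_M by blast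

end

theorem proposition13:
  fixes sc :: "complex \<Rightarrow> 'g::euclidean_space \<Rightarrow> 'g"
    and br :: "'g \<Rightarrow> 'g \<Rightarrow> 'g"
    and u a aplus :: "'g set"
    and \<tau> :: "'g \<Rightarrow> 'g"
    and U :: "('g \<Rightarrow>\<^sub>L 'g) set"
    and H :: 'g
  assumes "complex_lie_algebra sc br"
    and "semisimple sc br"
    and "compact_real_form sc br u"
    and "cartan_involution sc u \<tau>"
    and "maximal_abelian br (sc \<i> ` u) a"
    and "weyl_chamber br a aplus"
    and "H \<in> closure aplus"
    and "compact_group_of sc br u U"
  shows "symplectic_form_on (Uad_orbit br \<tau> U (sc \<i> ` u) H) (\<lambda>p. Omega sc br \<tau>)"
proof -
  \<comment> \<open>A chamber lies in the closed subspace a, so its closure does as well. This puts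
    H in i u and produces \<open>h\<close>.\<close>
  have "aplus \<subseteq> a"
    using assms(6) in_components_subset unfolding weyl_chamber_def by fastforce
  moreover have "closed a"
    using assms(5) by (auto simp: maximal_abelian_def abelian_subspace_def intro: closed_subspace)
  ultimately have "H \<in> a" using assms(7) closure_minimal by blast
  then obtain h where hu: "h \<in> u" and H: "H = sc \<i> h"
    using assms(5) by (auto simp: maximal_abelian_def)
  interpret compact_group_orbit sc br u \<tau> U h
    using assms hu
    by (simp add: compact_group_orbit_def compact_form_def compact_form_axioms_def compact_group_orbit_axioms_def)
  show ?thesis
    using symplectic_M unfolding M_def H .
qed

end
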